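(* Let $a,b,c\in\mathbb{R}$, let $x,y,z$ be the canonical coordinates of $\mathbb{R}^3$, and consider the following quadratic Poisson tensors $\Lambda_1,\ldots,\Lambda_{13}$ of $\mathbb{R}^3$ (depending on the parameters $a,b,c$). If $\Lambda$ is one of these tensors and $\dim\mathfrak{g}_\Lambda>3$, then there are mutually commuting linear vector fields $Y_1,Y_2,Y_3$ and $\alpha,\beta,\gamma\in\mathbb{R}$ such that $\Lambda=\alpha Y_{23}+\beta Y_{31}+\gamma Y_{12}$, and $\Lambda$ is strongly $r$-matrix induced (SRMI). Moreover, the following classification holds; whenever a tensor is not SRMI, the displayed formula writes it as the sum of an SRMI Poisson structure (the combination of the $Y_{ij}$) and a compatible quadratic Poisson tensor (the remaining term). (A) With $Y_1=x\partial_1$, $Y_2=y\partial_2$, $Y_3=z\partial_3$: - $\Lambda_1=a\,yz\,\partial_{23}+b\,xz\,\partial_{31}+c\,xy\,\partial_{12}$ is SRMI for all $a,b,c$, and $\Lambda_1=aY_{23}+bY_{31}+cY_{12}$. - $\Lambda_4=a\,yz\,\partial_{23}+a\,xz\,\partial_{31}+(b\,xy+z^2)\partial_{12}$ is not SRMI if and only if $(a,b)\neq(0,0)$, and $\Lambda_4=a(Y_{23}+Y_{31})+bY_{12}+\frac13\Pi_{z^3}$. (B) With $Y_1=x\partial_1+y\partial_2$, $Y_2=x\partial_2-y\partial_1$, $Y_3=z\partial_3$: - $\Lambda_2=(2ax-by)z\,\partial_{23}+(bx+2ay)z\,\partial_{31}+a(x^2+y^2)\partial_{12}$ is SRMI for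 all $a,b$, and $\Lambda_2=2aY_{23}+bY_{31}+aY_{12}$. - $\Lambda_7=((2a+c)x-by)z\,\partial_{23}+(bx+(2a+c)y)z\,\partial_{31}+a(x^2+y^2)\partial_{12}$ is SRMI for all $a,b,c$, and $\Lambda_7=(2a+c)Y_{23}+bY_{31}+aY_{12}$. - $\Lambda_8=a\,xz\,\partial_{23}+a\,yz\,\partial_{31}+\left(\frac{a+b}{2}(x^2+y^2)\pm z^2\right)\partial_{12}$ is not SRMI if and only if $(a,b)\neq(0,0)$, and $\Lambda_8=aY_{23}+\frac{a+b}{2}Y_{12}\pm\frac13\Pi_{z^3}$. (C) With $Y_1=x\partial_1+y\partial_2$, $Y_2=x\partial_2$, $Y_3=z\partial_3$: - $\Lambda_3=(2x-ay)z\,\partial_{23}+a\,xz\,\partial_{31}+x^2\partial_{12}$ is SRMI for all $a$, and $\Lambda_3=2Y_{23}+aY_{31}+Y_{12}$. - $\Lambda_5=((2a+1)x+y)z\,\partial_{23}-xz\,\partial_{31}+a\,x^2\partial_{12}$ ($a\neq-\frac12$) is SRMI for all such $a$, and $\Lambda_5=(2a+1)Y_{23}-Y_{31}+aY_{12}$. - $\Lambda_6=a\,yz\,\partial_{23}-a\,xz\,\partial_{31}-\frac12x^2\partial_{12}$ is SRMI for all $a$, and $\Lambda_6=-aY_{31}-\frac12Y_{12}$. (D) With $Y_1=x\partial_1+y\partial_2+z\partial_3$, $Y_2=x\partial_2+y\partial_3$, $Y_3=x\partial_3$: - $\Lambda_9=(ax^2-\frac13y^2+\frac13xz)\partial_{23}+\frac13xy\,\partial_{31}-\frac13x^2\partial_{12}$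 is SRMI for all $a$, and $\Lambda_9=aY_{23}-\frac13Y_{12}$. - $\Lambda_{10}=(a\,y^2-(4a+1)xz)\partial_{23}+(2a+1)xy\,\partial_{31}-(2a+1)x^2\partial_{12}$ is not SRMI if and only if $a\neq-\frac13$, and $\Lambda_{10}=-(2a+1)Y_{12}+(3a+1)(y^2-2xz)\partial_{23}$. (E) With $Y_1=x\partial_1+y\partial_2+z\partial_3$, $Y_2=x\partial_2$, $Y_3=(ax+(3b+1)z)\partial_3$: - $\Lambda_{11}=(a\,x^2+(2b+1)xz)\partial_{23}+(b\,x^2+c\,z^2)\partial_{12}$ with $a=0$ is not SRMI if and only if $c\neq0$, and $\Lambda_{11}=Y_{23}+bY_{12}+\frac c3\Pi_{z^3}$. - $\Lambda_{12}=(a\,x^2+(2b+1)xz)\partial_{23}+(b\,x^2+c\,z^2)\partial_{12}$ with $a=1$ is not SRMI if and only if $c\neq0$, and $\Lambda_{12}=Y_{23}+bY_{12}+\frac c3\Pi_{z^3}$. - $\Lambda_{13}=(a\,x^2+(2b+1)xz+z^2)\partial_{23}+(b\,x^2+c\,z^2+2xz)\partial_{12}$ is not SRMI for any $a,b,c$, and $\Lambda_{13}=Y_{23}+bY_{12}+\Pi_{\frac c3z^3+xz^2}$.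
   Context: Notation: $\partial_1,\partial_2,\partial_3$ are the partial derivatives with respect to $x,y,z$; $\partial_{ij}=\partial_i\wedge\partial_j$; $Y_{ij}=Y_i\wedge Y_j$. For a function $f$ on $\mathbb{R}^3$, $\Pi_f=(\partial_1f)\partial_{23}+(\partial_2f)\partial_{31}+(\partial_3f)\partial_{12}$. Two Poisson tensors are compatible if their sum is again a Poisson tensor, i.e. if their Schouten-Nijenhuis bracket vanishes. A quadratic Poisson tensor of $\mathbb{R}^n$ is a bivector field $\Lambda$ whose coefficients are homogeneous quadratic polynomials (possibly zero) and which satisfies $[\Lambda,\Lambda]_{\mathrm{SN}}=0$ (Schouten-Nijenhuis bracket). Its stabilizer $\mathfrak{g}_\Lambda$ is the Lie algebra of linear vector fields $Y$ with $[\Lambda,Y]_{\mathrm{SN}}=0$, identified with a Lie subalgebra of $\mathfrak{g}=\mathfrak{gl}(n,\mathbb{R})$ via the Lie algebra isomorphism $J^1:\mathfrak{g}\to\{\text{linear vector fields}\}$, $E_{ij}\mapsto x_i\partial_j$. Let $J^2(a\wedge b)=J^1a\wedge J^1b$ be the induced linear map from $\mathfrak{g}\wedge\mathfrak{g}$ to quadratic bivector fields. A classical $r$-matrix is $r\in\mathfrak{g}\wedge\mathfrak{g}$ with $[r,r]_{\mathrm{SN}}=0$, where here $[\cdot,\cdot]_{\mathrm{SN}}$ is the algebraic Schouten bracket on $\bigwedge\mathfrak{g}$ extending the Lie bracket. $\Lambda$ is called strongly $r$-matrix induced (SRMI) if $\Lambda=J^2r$ for some classical $r$-matrix $r\in\mathfrak{g}_\Lambda\wedge\mathfrak{g}_\Lambda$.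 The tensors $\Lambda_1,\ldots,\Lambda_{13}$ are the classes 1 to 13 of the Dufour-Haraki classification of quadratic Poisson structures of $\mathbb{R}^3$. *)

theory Defs
  imports "HOL-Analysis.Analysis"
begin

text \<open>
  A vector field on \<open>\<real>\<^sup>n\<close> is a map from \<open>real^'n\<close> to itself. A bivector field is given by its
  skew-symmetric coefficient matrix, the entry with indices \<open>i, j\<close> being the coefficient of
  \<open>\<partial>\<^sub>i \<and> \<partial>\<^sub>j\<close>; in these coordinates \<open>u \<and> v = u \<otimes> v - v \<otimes> u\<close>.
\<close>

definition wedge :: "real^'m \<Rightarrow> real^'m \<Rightarrow> real^'m^'m" where
  "wedge u v = (\<chi> i j. u$i * v$j - v$i * u$j)"

definition wedge_field :: "(real^'n \<Rightarrow> real^'n) \<Rightarrow> (real^'n \<Rightarrow> real^'n) \<Rightarrow> real^'n \<Rightarrow> real^'n^'n" where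
  "wedge_field X Y = (\<lambda>v. wedge (X v) (Y v))"

definition partial :: "'n \<Rightarrow> (real^'n \<Rightarrow> real) \<Rightarrow> real^'n \<Rightarrow> real" where
  "partial i f v = frechet_derivative f (at v) (axis i 1)"

definition lie_field :: "(real^'n \<Rightarrow> real^'n) \<Rightarrow> (real^'n \<Rightarrow> real^'n) \<Rightarrow> real^'n \<Rightarrow> real^'n" where
  "lie_field X Y = (\<lambda>v. \<chi> i. \<Sum>l\<in>UNIV.
     X v $ l * partial l (\<lambda>w. Y w $ i) v - Y v $ l * partial l (\<lambda>w. X w $ i) v)"

text \<open>
  Schouten-Nijenhuis brackets, in coordinates, with the sign convention
  \<open>[X\<^sub>1 \<and> X\<^sub>2, Y] = [X\<^sub>1, Y] \<and> X\<^sub>2 - [X\<^sub>2, Y] \<and> X\<^sub>1\<close> and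
  \<open>[X\<^sub>1 \<and> X\<^sub>2, Y\<^sub>1 \<and> Y\<^sub>2] = [X\<^sub>1, Y\<^sub>1] \<and> X\<^sub>2 \<and> Y\<^sub>2 - [X\<^sub>1, Y\<^sub>2] \<and> X\<^sub>2 \<and> Y\<^sub>1 - [X\<^sub>2, Y\<^sub>1] \<and> X\<^sub>1 \<and> Y\<^sub>2 + [X\<^sub>2, Y\<^sub>2] \<and> X\<^sub>1 \<and> Y\<^sub>1\<close>:
  first the bracket of a bivector field with a vector field, then that of two bivector fields.
\<close>

definition sn_bivec_vec :: "(real^'n \<Rightarrow> real^'n^'n) \<Rightarrow> (real^'n \<Rightarrow> real^'n) \<Rightarrow> real^'n \<Rightarrow> real^'n^'n" where
  "sn_bivec_vec P Y = (\<lambda>v. \<chi> i j. \<Sum>l\<in>UNIV.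
       P v $ l $ j * partial l (\<lambda>w. Y w $ i) v
     + P v $ i $ l * partial l (\<lambda>w. Y w $ j) v
     - Y v $ l * partial l (\<lambda>w. P w $ i $ j) v)"

definition sn_bivec_bivec ::
  "(real^'n \<Rightarrow> real^'n^'n) \<Rightarrow> (real^'n \<Rightarrow> real^'n^'n) \<Rightarrow> real^'n \<Rightarrow> real^'n^'n^'n" where
  "sn_bivec_bivec P Q = (\<lambda>v. \<chi> i j k. \<Sum>l\<in>UNIV.
       P v $ i $ l * partial l (\<lambda>w. Q w $ j $ k) v + Q v $ i $ l * partial l (\<lambda>w. P w $ j $ k) v
     + P v $ j $ l * partial l (\<lambda>w. Q w $ k $ i) v + Q v $ j $ l * partial l (\<lambda>w. P w $ k $ i) v
     + P v $ k $ l * partial l (\<lambda>w. Q w $ i $ j) v + Q v $ k $ l * partial l (\<lambda>w. P w $ i $ j) v)"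

definition homogeneous_quadratic :: "(real^'n \<Rightarrow> real) \<Rightarrow> bool" where
  "homogeneous_quadratic f \<longleftrightarrow>
     (\<exists>C :: real^'n^'n. \<forall>v. f v = (\<Sum>k\<in>UNIV. \<Sum>l\<in>UNIV. C$k$l * v$k * v$l))"

definition quadratic_poisson :: "(real^'n \<Rightarrow> real^'n^'n) \<Rightarrow> bool" where
  "quadratic_poisson P \<longleftrightarrow>
     (\<forall>v. transpose (P v) = - P v) \<and>
     (\<forall>i j. homogeneous_quadratic (\<lambda>v. P v $ i $ j)) \<and>
     (\<forall>v. sn_bivec_bivec P P v = 0)"

text \<open>
  As \<open>[P + Q, P + Q] = [P, P] + 2 [P, Q] + [Q, Q]\<close>, for quadratic Poisson tensors this says that
  their sum is again a Poisson tensor.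
\<close>

definition compatible :: "(real^'n \<Rightarrow> real^'n^'n) \<Rightarrow> (real^'n \<Rightarrow> real^'n^'n) \<Rightarrow> bool" where
  "compatible P Q \<longleftrightarrow> (\<forall>v. sn_bivec_bivec P Q v = 0)"

definition elem_mat :: "'n \<Rightarrow> 'n \<Rightarrow> real^'n^'n" where
  "elem_mat i j = axis i (axis j 1)"

definition J1 :: "real^'n^'n \<Rightarrow> real^'n \<Rightarrow> real^'n" where
  "J1 A = (\<lambda>v. \<Sum>i\<in>UNIV. \<Sum>j\<in>UNIV. A$i$j *\<^sub>R (v$i *\<^sub>R axis j 1))"

definition stabilizer :: "(real^'n \<Rightarrow> real^'n^'n) \<Rightarrow> (real^'n^'n) set" where
  "stabilizer P = {A. \<forall>v. sn_bivec_vec P (J1 A) v = 0}"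

text \<open>
  Multivectors over \<open>\<gg>\<ll>(n, \<real>)\<close> are again skew-symmetric coefficient tensors, now with respect to
  the basis \<open>elem_mat i j\<close>, so that every tensor factor carries two indices:
  \<open>r $ i $ j $ k $ l\<close> is the coefficient of \<open>elem_mat i j \<otimes> elem_mat k l\<close>. Hence
  \<open>r\<close> is one half of the sum of all \<open>r $ i $ j $ k $ l\<close> times
  \<open>elem_mat i j \<and> elem_mat k l\<close>, which explains the factors \<open>1 / 2\<close> and \<open>1 / 4\<close> below.
\<close>

type_synonym 'n gl_bivector = "real^'n^'n^'n^'n"
type_synonym 'n gl_trivector = "real^'n^'n^'n^'n^'n^'n"

definition gl_bracket :: "real^'n^'n \<Rightarrow> real^'n^'n \<Rightarrow> real^'n^'n" where
  "gl_bracket A B = A ** B - B ** A"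

definition gl_wedge :: "real^'n^'n \<Rightarrow> real^'n^'n \<Rightarrow> ('n::finite) gl_bivector" where
  "gl_wedge A B = (\<chi> i j k l. A$i$j * B$k$l - B$i$j * A$k$l)"

definition gl_wedge3 :: "real^'n^'n \<Rightarrow> real^'n^'n \<Rightarrow> real^'n^'n \<Rightarrow> ('n::finite) gl_trivector" where
  "gl_wedge3 A B C = (\<chi> i j k l p q.
       A$i$j * B$k$l * C$p$q + B$i$j * C$k$l * A$p$q + C$i$j * A$k$l * B$p$q
     - A$i$j * C$k$l * B$p$q - C$i$j * B$k$l * A$p$q - B$i$j * A$k$l * C$p$q)"

text \<open>
  The algebraic Schouten bracket on decomposable bivectors \<open>A \<and> B\<close>, \<open>C \<and> D\<close>, and its bilinear
  extension.
\<close>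

definition gl_schouten_wedge ::
  "real^'n^'n \<Rightarrow> real^'n^'n \<Rightarrow> real^'n^'n \<Rightarrow> real^'n^'n \<Rightarrow> ('n::finite) gl_trivector" where
  "gl_schouten_wedge A B C D =
       gl_wedge3 (gl_bracket A C) B D - gl_wedge3 (gl_bracket A D) B C
     - gl_wedge3 (gl_bracket B C) A D + gl_wedge3 (gl_bracket B D) A C"

definition gl_schouten :: "('n::finite) gl_bivector \<Rightarrow> ('n::finite) gl_bivector \<Rightarrow> ('n::finite) gl_trivector" where
  "gl_schouten r s = (1 / 4) *\<^sub>R
     (\<Sum>i\<in>UNIV. \<Sum>j\<in>UNIV. \<Sum>k\<in>UNIV. \<Sum>l\<in>UNIV. \<Sum>i'\<in>UNIV. \<Sum>j'\<in>UNIV. \<Sum>k'\<in>UNIV. \<Sum>l'\<in>UNIV.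
       (r$i$j$k$l * s$i'$j'$k'$l') *\<^sub>R
         gl_schouten_wedge (elem_mat i j) (elem_mat k l) (elem_mat i' j') (elem_mat k' l'))"

definition wedge_square :: "(real^'n^'n) set \<Rightarrow> ('n::finite) gl_bivector set" where
  "wedge_square S = span {gl_wedge A B | A B. A \<in> S \<and> B \<in> S}"

definition classical_r_matrix :: "('n::finite) gl_bivector \<Rightarrow> bool" where
  "classical_r_matrix r \<longleftrightarrow> r \<in> wedge_square UNIV \<and> gl_schouten r r = 0"

definition J2 :: "('n::finite) gl_bivector \<Rightarrow> real^'n \<Rightarrow> real^'n^'n" where
  "J2 r = (\<lambda>v. (1 / 2) *\<^sub>R (\<Sum>i\<in>UNIV. \<Sum>j\<in>UNIV. \<Sum>k\<in>UNIV. \<Sum>l\<in>UNIV.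
     r$i$j$k$l *\<^sub>R wedge_field (J1 (elem_mat i j)) (J1 (elem_mat k l)) v))"

definition srmi :: "(real^'n \<Rightarrow> real^'n^'n) \<Rightarrow> bool" where
  "srmi P \<longleftrightarrow> (\<exists>r. classical_r_matrix r \<and> r \<in> wedge_square (stabilizer P) \<and> P = J2 r)"

text \<open>\<open>S\<close> is an SRMI Poisson structure and \<open>R\<close> a quadratic Poisson tensor compatible with it.\<close>

definition srmi_splitting :: "(real^'n \<Rightarrow> real^'n^'n) \<Rightarrow> (real^'n \<Rightarrow> real^'n^'n) \<Rightarrow> bool" where
  "srmi_splitting S R \<longleftrightarrow> quadratic_poisson S \<and> srmi S \<and> quadratic_poisson R \<and> compatible S R"

definition add_field :: "(real^'n \<Rightarrow> real^'n^'n) \<Rightarrow> (real^'n \<Rightarrow> real^'n^'n) \<Rightarrow> real^'n \<Rightarrow> real^'n^'n" where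
  "add_field P Q = (\<lambda>v. P v + Q v)"

definition scale_field :: "real \<Rightarrow> (real^'n \<Rightarrow> real^'n^'n) \<Rightarrow> real^'n \<Rightarrow> real^'n^'n" where
  "scale_field c P = (\<lambda>v. c *\<^sub>R P v)"

definition xyz :: "(real \<Rightarrow> real \<Rightarrow> real \<Rightarrow> 'b) \<Rightarrow> real^3 \<Rightarrow> 'b" where
  "xyz f v = f (v$1) (v$2) (v$3)"

text \<open>The bivector \<open>p \<partial>\<^sub>2\<^sub>3 + q \<partial>\<^sub>3\<^sub>1 + r \<partial>\<^sub>1\<^sub>2\<close> and the vector \<open>p \<partial>\<^sub>1 + q \<partial>\<^sub>2 + r \<partial>\<^sub>3\<close>.\<close>

definition bivec :: "real \<Rightarrow> real \<Rightarrow> real \<Rightarrow> real^3^3" where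
  "bivec p q r = p *\<^sub>R wedge (axis 2 1) (axis 3 1) + q *\<^sub>R wedge (axis 3 1) (axis 1 1)
     + r *\<^sub>R wedge (axis 1 1) (axis 2 1)"

definition vec3 :: "real \<Rightarrow> real \<Rightarrow> real \<Rightarrow> real^3" where
  "vec3 p q r = p *\<^sub>R axis 1 1 + q *\<^sub>R axis 2 1 + r *\<^sub>R axis 3 1"

text \<open>\<open>wedge_comb Y\<^sub>1 Y\<^sub>2 Y\<^sub>3 \<alpha> \<beta> \<gamma> = \<alpha> Y\<^sub>2\<^sub>3 + \<beta> Y\<^sub>3\<^sub>1 + \<gamma> Y\<^sub>1\<^sub>2\<close>\<close>

definition wedge_comb :: "(real^'n \<Rightarrow> real^'n) \<Rightarrow> (real^'n \<Rightarrow> real^'n) \<Rightarrow> (real^'n \<Rightarrow> real^'n) \<Rightarrow>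
    real \<Rightarrow> real \<Rightarrow> real \<Rightarrow> real^'n \<Rightarrow> real^'n^'n" where
  "wedge_comb Y1 Y2 Y3 \<alpha> \<beta> \<gamma> = (\<lambda>v. \<alpha> *\<^sub>R wedge_field Y2 Y3 v + \<beta> *\<^sub>R wedge_field Y3 Y1 v
     + \<gamma> *\<^sub>R wedge_field Y1 Y2 v)"

definition Pi_field :: "(real^3 \<Rightarrow> real) \<Rightarrow> real^3 \<Rightarrow> real^3^3" where
  "Pi_field f = (\<lambda>v. bivec (partial 1 f v) (partial 2 f v) (partial 3 f v))"

text \<open>The Dufour-Haraki classes; \<open>\<epsilon> \<in> {1, -1}\<close> is the sign \<open>\<plusminus>\<close> in the eighth one.\<close>

definition Lambda1 :: "real \<Rightarrow> real \<Rightarrow> real \<Rightarrow> real^3 \<Rightarrow> real^3^3" where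
  "Lambda1 a b c = xyz (\<lambda>x y z. bivec (a*y*z) (b*x*z) (c*x*y))"

definition Lambda2 :: "real \<Rightarrow> real \<Rightarrow> real^3 \<Rightarrow> real^3^3" where
  "Lambda2 a b = xyz (\<lambda>x y z. bivec ((2*a*x - b*y)*z) ((b*x + 2*a*y)*z) (a*(x^2 + y^2)))"

definition Lambda3 :: "real \<Rightarrow> real^3 \<Rightarrow> real^3^3" where
  "Lambda3 a = xyz (\<lambda>x y z. bivec ((2*x - a*y)*z) (a*x*z) (x^2))"

definition Lambda4 :: "real \<Rightarrow> real \<Rightarrow> real^3 \<Rightarrow> real^3^3" where
  "Lambda4 a b = xyz (\<lambda>x y z. bivec (a*y*z) (a*x*z) (b*x*y + z^2))"

definition Lambda5 :: "real \<Rightarrow> real^3 \<Rightarrow> real^3^3" where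
  "Lambda5 a = xyz (\<lambda>x y z. bivec (((2*a + 1)*x + y)*z) (- (x*z)) (a*x^2))"

definition Lambda6 :: "real \<Rightarrow> real^3 \<Rightarrow> real^3^3" where
  "Lambda6 a = xyz (\<lambda>x y z. bivec (a*y*z) (- (a*x*z)) (- (1/2)*x^2))"

definition Lambda7 :: "real \<Rightarrow> real \<Rightarrow> real \<Rightarrow> real^3 \<Rightarrow> real^3^3" where
  "Lambda7 a b c = xyz (\<lambda>x y z. bivec (((2*a + c)*x - b*y)*z) ((b*x + (2*a + c)*y)*z)
     (a*(x^2 + y^2)))"

definition Lambda8 :: "real \<Rightarrow> real \<Rightarrow> real \<Rightarrow> real^3 \<Rightarrow> real^3^3" where
  "Lambda8 \<epsilon> a b = xyz (\<lambda>x y z. bivec (a*x*z) (a*y*z) ((a + b)/2*(x^2 + y^2) + \<epsilon>*z^2))"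

definition Lambda9 :: "real \<Rightarrow> real^3 \<Rightarrow> real^3^3" where
  "Lambda9 a = xyz (\<lambda>x y z. bivec (a*x^2 - (1/3)*y^2 + (1/3)*x*z) ((1/3)*x*y) (- (1/3)*x^2))"

definition Lambda10 :: "real \<Rightarrow> real^3 \<Rightarrow> real^3^3" where
  "Lambda10 a = xyz (\<lambda>x y z. bivec (a*y^2 - (4*a + 1)*x*z) ((2*a + 1)*x*y) (- (2*a + 1)*x^2))"

definition Lambda11 :: "real \<Rightarrow> real \<Rightarrow> real^3 \<Rightarrow> real^3^3" where
  "Lambda11 b c = xyz (\<lambda>x y z. bivec ((2*b + 1)*x*z) 0 (b*x^2 + c*z^2))"

definition Lambda12 :: "real \<Rightarrow> real \<Rightarrow> real^3 \<Rightarrow> real^3^3" where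
  "Lambda12 b c = xyz (\<lambda>x y z. bivec (x^2 + (2*b + 1)*x*z) 0 (b*x^2 + c*z^2))"

definition Lambda13 :: "real \<Rightarrow> real \<Rightarrow> real \<Rightarrow> real^3 \<Rightarrow> real^3^3" where
  "Lambda13 a b c = xyz (\<lambda>x y z. bivec (a*x^2 + (2*b + 1)*x*z + z^2) 0 (b*x^2 + c*z^2 + 2*x*z))"

definition dufour_haraki :: "(real^3 \<Rightarrow> real^3^3) set" where
  "dufour_haraki =
     {Lambda1 a b c | a b c. True} \<union> {Lambda2 a b | a b. True} \<union> {Lambda3 a | a. True} \<union>
     {Lambda4 a b | a b. True} \<union> {Lambda5 a | a. a \<noteq> - (1/2)} \<union> {Lambda6 a | a. True} \<union>
     {Lambda7 a b c | a b c. True} \<union> {Lambda8 \<epsilon> a b | \<epsilon> a b. \<epsilon> \<in> {1, -1}} \<union>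
     {Lambda9 a | a. True} \<union> {Lambda10 a | a. True} \<union> {Lambda11 b c | b c. True} \<union>
     {Lambda12 b c | b c. True} \<union> {Lambda13 a b c | a b c. True}"

definition comb_A :: "real \<Rightarrow> real \<Rightarrow> real \<Rightarrow> real^3 \<Rightarrow> real^3^3" where
  "comb_A = wedge_comb (xyz (\<lambda>x y z. vec3 x 0 0)) (xyz (\<lambda>x y z. vec3 0 y 0))
     (xyz (\<lambda>x y z. vec3 0 0 z))"

definition comb_B :: "real \<Rightarrow> real \<Rightarrow> real \<Rightarrow> real^3 \<Rightarrow> real^3^3" where
  "comb_B = wedge_comb (xyz (\<lambda>x y z. vec3 x y 0)) (xyz (\<lambda>x y z. vec3 (- y) x 0))
     (xyz (\<lambda>x y z. vec3 0 0 z))"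

definition comb_C :: "real \<Rightarrow> real \<Rightarrow> real \<Rightarrow> real^3 \<Rightarrow> real^3^3" where
  "comb_C = wedge_comb (xyz (\<lambda>x y z. vec3 x y 0)) (xyz (\<lambda>x y z. vec3 0 x 0))
     (xyz (\<lambda>x y z. vec3 0 0 z))"

definition comb_D :: "real \<Rightarrow> real \<Rightarrow> real \<Rightarrow> real^3 \<Rightarrow> real^3^3" where
  "comb_D = wedge_comb (xyz (\<lambda>x y z. vec3 x y z)) (xyz (\<lambda>x y z. vec3 0 x y))
     (xyz (\<lambda>x y z. vec3 0 0 x))"

text \<open>In family E the field \<open>Y\<^sub>3\<close> depends on the parameters \<open>a\<close>, \<open>b\<close> of the tensor.\<close>

definition comb_E :: "real \<Rightarrow> real \<Rightarrow> real \<Rightarrow> real \<Rightarrow> real \<Rightarrow> real^3 \<Rightarrow> real^3^3" where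
  "comb_E a b = wedge_comb (xyz (\<lambda>x y z. vec3 x y z)) (xyz (\<lambda>x y z. vec3 0 x 0))
     (xyz (\<lambda>x y z. vec3 0 0 (a*x + (3*b + 1)*z)))"

end

theory Submission
  imports Defs
begin

text \<open>
  If \<open>A\<close>, \<open>B\<close>, \<open>C\<close> commute in \<open>\<gg>\<ll>(n)\<close>, then every combination of \<open>B \<and> C\<close>, \<open>C \<and> A\<close>,
  \<open>A \<and> B\<close> is a classical \<open>r\<close>-matrix, and the induced bivector field is stabilized by \<open>A\<close>, \<open>B\<close>, \<open>C\<close>;
  this yields all positive claims. For the negative ones, the stabilizer is determined by comparing
  coefficients. Outside the exceptional parameter values it has dimension at most 3, and some linear
  functional on quadratic bivector fields vanishes on all wedge products of elements of the stabilizer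
  but not on the tensor itself, so that no \<open>r \<in> \<gg>\<^sub>\<Lambda> \<and> \<gg>\<^sub>\<Lambda>\<close>, whether an \<open>r\<close>-matrix or not, induces it.
\<close>

section \<open>Partial derivatives of polynomial expressions\<close>

lemma partial_eqI:
  assumes "(f has_derivative f') (at v)"
  shows "partial l f v = f' (axis l 1)"
  using frechet_derivative_at[OF assms] by (simp add: partial_def)

lemma partial_const [simp]: "partial l (\<lambda>w. c) v = 0"
  by (rule partial_eqI[of _ "\<lambda>h. 0"]) simp

lemma differentiable_component [simp]: "(\<lambda>w::real^'n. w$i) differentiable at v"
  by (rule bounded_linear_imp_differentiable) (rule bounded_linear_vec_nth)

lemma partial_component [simp]: "partial l (\<lambda>w. w$i) v = (if i = l then 1 else 0)"
  by (subst partial_eqI[of _ "\<lambda>h. h$i"])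
     (auto simp: axis_def intro!: bounded_linear_imp_has_derivative bounded_linear_vec_nth)

context
  fixes f g :: "real^'n \<Rightarrow> real" and v :: "real^'n"
  assumes f: "f differentiable at v" and g: "g differentiable at v"
begin

private lemma has: "(f has_derivative frechet_derivative f (at v)) (at v)"
  "(g has_derivative frechet_derivative g (at v)) (at v)"
  using f g by (simp_all add: frechet_derivative_works)

lemma partial_add: "partial l (\<lambda>w. f w + g w) v = partial l f v + partial l g v"
  using partial_eqI[OF has_derivative_add[OF has]] by (simp add: partial_def)

lemma partial_diff: "partial l (\<lambda>w. f w - g w) v = partial l f v - partial l g v"
  using partial_eqI[OF has_derivative_diff[OF has]] by (simp add: partial_def)

lemma partial_mult: "partial l (\<lambda>w. f w * g w) v = f v * partial l g v + partial l f v * g v"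
  using partial_eqI[OF has_derivative_mult[OF has]] by (simp add: partial_def)

end

lemma partial_minus:
  assumes "f differentiable at v"
  shows "partial l (\<lambda>w. - f w) v = - partial l f v"
  using partial_diff[OF differentiable_const[of 0] assms, of l] by simp

lemma partial_divide_const:
  assumes "f differentiable at v"
  shows "partial l (\<lambda>w. f w / c) v = partial l f v / c"
  using partial_mult[OF assms differentiable_const[of "inverse c"], of l]
  by (simp add: divide_inverse)

lemma partial_power:
  assumes "f differentiable at v"
  shows "partial l (\<lambda>w. f w ^ n) v = real n * f v ^ (n - 1) * partial l f v"
proof (induction n)
  case (Suc n)
  have "partial l (\<lambda>w. f w ^ Suc n) v = f v * partial l (\<lambda>w. f w ^ n) v + partial l f v * f v ^ n"
    using partial_mult[OF assms differentiable_power[OF assms], of l n] by simp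
  \<comment> \<open>The induction hypothesis contains the truncated \<open>n - 1\<close>, hence the
    separate case \<open>n = 0\<close>.\<close>
  with Suc show ?case by (cases n) (auto simp: algebra_simps)
qed simp

lemma partial_sum:
  assumes "\<And>k. k \<in> K \<Longrightarrow> f k differentiable at v"
  shows "partial l (\<lambda>w. \<Sum>k\<in>K. f k w) v = (\<Sum>k\<in>K. partial l (f k) v)"
  using assms
proof (induction K rule: infinite_finite_induct)
  case (insert k K)
  then have "(\<lambda>w. \<Sum>k\<in>K. f k w) differentiable at v"
    by (intro differentiable_sum) auto
  with insert show ?case by (simp add: partial_add)
qed simp_all

lemmas partial_simps =
  partial_add partial_diff partial_mult partial_minus partial_divide_const partial_power partial_sum

section \<open>Linear vector fields and their brackets\<close>

lemma J1_component: "J1 A v $ j = (\<Sum>i\<in>UNIV. A$i$j * v$i)"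
  by (simp add: J1_def axis_def if_distrib cong: if_cong)

lemma linear_J1: "linear (J1 A)"
  by (rule linearI)
     (simp_all add: vec_eq_iff J1_component algebra_simps sum.distrib sum_distrib_left)

lemma linear_J1_matrix: "linear (\<lambda>A. J1 A v)"
  by (rule linearI)
     (simp_all add: vec_eq_iff J1_component algebra_simps sum.distrib sum_distrib_left)

lemma partial_J1 [simp]: "partial l (\<lambda>w. J1 A w $ j) v = A$l$j"
  by (simp add: J1_component partial_simps if_distrib[of "(*) _"] cong: if_cong)

lemma differentiable_J1 [simp]: "(\<lambda>w. J1 A w $ j) differentiable at v"
  by (simp add: J1_component)

text \<open>\<open>J1 A v\<close> is the row vector \<open>v\<close> times \<open>A\<close>, so the
  field of \<open>A ** B\<close> is \<open>J1 B\<close> applied to \<open>J1 A v\<close>.\<close>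

lemma J1_matrix_mult: "J1 (A ** B) v $ j = (\<Sum>l\<in>UNIV. J1 A v $ l * B$l$j)"
  unfolding J1_component matrix_matrix_mult_def
  by (simp add: sum_distrib_left sum_distrib_right mult_ac) (rule sum.swap)

text \<open>Since matrices act on row vectors, the order of factors is preserved and
  \<open>J1\<close> is a homomorphism, not an antihomomorphism.\<close>

lemma lie_field_J1: "lie_field (J1 A) (J1 B) v = J1 (gl_bracket A B) v"
  by (simp add: vec_eq_iff lie_field_def gl_bracket_def linear_diff[OF linear_J1_matrix]
      J1_matrix_mult sum_subtractf)

lemma J1_gl_bracket:
  "J1 (gl_bracket A B) v $ j = (\<Sum>l\<in>UNIV. J1 A v $ l * B$l$j - J1 B v $ l * A$l$j)"
  by (simp add: gl_bracket_def linear_diff[OF linear_J1_matrix] J1_matrix_mult sum_subtractf)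

text \<open>The bracket with a vector field is a derivation of the wedge product. For linear fields
  the partial derivatives are matrix entries, and both sides agree summand by summand in
  \<open>l\<close>.\<close>

lemma sn_bivec_vec_wedge_field:
  "sn_bivec_vec (wedge_field (J1 A) (J1 B)) (J1 C) v
   = wedge (J1 (gl_bracket A C) v) (J1 B v) + wedge (J1 A v) (J1 (gl_bracket B C) v)"
proof -
  have p: "partial l (\<lambda>w. J1 A w $ i * J1 B w $ j - J1 B w $ i * J1 A w $ j) v
    = J1 A v $ i * B$l$j + A$l$i * J1 B v $ j - (J1 B v $ i * A$l$j + B$l$i * J1 A v $ j)" for i j l
    by (simp add: partial_simps)
  have "sn_bivec_vec (wedge_field (J1 A) (J1 B)) (J1 C) v $ i $ j
     = (wedge (J1 (gl_bracket A C) v) (J1 B v) + wedge (J1 A v) (J1 (gl_bracket B C) v)) $ i $ j"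
    for i j
    unfolding sn_bivec_vec_def wedge_field_def wedge_def
    by (simp only: vec_lambda_beta vector_add_component J1_gl_bracket p partial_J1
        sum_distrib_left sum_distrib_right flip: sum_subtractf sum.distrib)
       (intro sum.cong refl, simp only: algebra_simps)
  then show ?thesis by (simp add: vec_eq_iff)
qed

section \<open>Expansion in elementary matrices and the map \<open>J2\<close>\<close>

lemma elem_mat_component: "elem_mat i j $ k $ l = (if k = i \<and> l = j then 1 else 0)"
  by (simp add: elem_mat_def axis_def)

lemma elem_mat_expansion: "A = (\<Sum>i\<in>UNIV. \<Sum>j\<in>UNIV. A$i$j *\<^sub>R elem_mat i j)"
proof -
  have "(\<Sum>i\<in>UNIV. \<Sum>j\<in>UNIV. A$i$j *\<^sub>R elem_mat i j) $ k $ l = A$k$l" for k l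
  proof -
    have "(\<Sum>i\<in>UNIV. \<Sum>j\<in>UNIV. A$i$j *\<^sub>R elem_mat i j) $ k $ l
      = (\<Sum>i\<in>UNIV. \<Sum>j\<in>UNIV. if i = k then if j = l then A$i$j else 0 else 0)"
      unfolding sum_component
      by (intro sum.cong) (auto simp: elem_mat_component)
    also have "\<dots> = (\<Sum>i\<in>UNIV. if i = k then A$i$l else 0)"
      by (intro sum.cong refl) auto
    finally show ?thesis by simp
  qed
  then show ?thesis by (simp add: vec_eq_iff)
qed

text \<open>Applied to one argument at a time, this collapses the sums over elementary matrices in
  \<open>J2\<close> and \<open>gl_schouten\<close>.\<close>

lemma linear_elem_mat_expansion:
  fixes f :: "real^'n^'n \<Rightarrow> 'b::real_vector"
  assumes "linear f"
  shows "f A = (\<Sum>i\<in>UNIV. \<Sum>j\<in>UNIV. A$i$j *\<^sub>R f (elem_mat i j))"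
proof -
  have "f A = f (\<Sum>i\<in>UNIV. \<Sum>j\<in>UNIV. A$i$j *\<^sub>R elem_mat i j)"
    by (subst elem_mat_expansion) (rule refl)
  also have "\<dots> = (\<Sum>i\<in>UNIV. \<Sum>j\<in>UNIV. A$i$j *\<^sub>R f (elem_mat i j))"
    by (simp only: linear_sum[OF assms] linear_cmul[OF assms])
  finally show ?thesis .
qed

lemma J2_add: "J2 (r + s) = add_field (J2 r) (J2 s)"
  by (simp only: fun_eq_iff J2_def add_field_def vector_add_component scaleR_left_distrib
      sum.distrib scaleR_right_distrib) simp

lemma J2_scale: "J2 (c *\<^sub>R r) = scale_field c (J2 r)"
  by (simp only: fun_eq_iff J2_def scale_field_def vector_scaleR_component real_scaleR_def
      scaleR_sum_right scaleR_scaleR mult_ac) simp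

lemma linear_wedge_left: "linear (\<lambda>x. wedge x w)"
  by (rule linearI) (simp_all add: wedge_def vec_eq_iff algebra_simps)

lemma linear_wedge_right: "linear (wedge w)"
  by (rule linearI) (simp_all add: wedge_def vec_eq_iff algebra_simps)

lemma linear_wedge_J1:
  "linear (\<lambda>A. wedge (J1 A v) w)" "linear (\<lambda>A. wedge w (J1 A v))"
  by (rule linear_compose[OF linear_J1_matrix linear_wedge_left, unfolded o_def],
      rule linear_compose[OF linear_J1_matrix linear_wedge_right, unfolded o_def])

lemma wedge_J1_expansion:
  "(\<Sum>i\<in>UNIV. \<Sum>j\<in>UNIV. \<Sum>k\<in>UNIV. \<Sum>l\<in>UNIV.
     (A$i$j * B$k$l) *\<^sub>R wedge (J1 (elem_mat i j) v) (J1 (elem_mat k l) v)) = wedge (J1 A v) (J1 B v)"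
  unfolding linear_elem_mat_expansion[OF linear_wedge_J1(1), where A = A]
  unfolding linear_elem_mat_expansion[OF linear_wedge_J1(2), where A = B]
  by (simp only: scaleR_sum_right scaleR_scaleR)

lemma wedge_minus: "wedge u v = - wedge v u"
  by (simp add: wedge_def vec_eq_iff)

text \<open>The two halves of \<open>gl_wedge A B\<close> contribute equally because
  \<open>wedge\<close> is skew, which cancels the factor 1/2 in \<open>J2\<close>.\<close>

lemma J2_gl_wedge:
  fixes A B :: "real^'n^'n"
  shows "J2 (gl_wedge A B) = wedge_field (J1 A) (J1 B)"
proof
  fix v :: "real^'n"
  have "J2 (gl_wedge A B) v = (1/2) *\<^sub>R (wedge (J1 A v) (J1 B v) - wedge (J1 B v) (J1 A v))"
    unfolding J2_def gl_wedge_def wedge_field_def vec_lambda_beta scaleR_left_diff_distrib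
      sum_subtractf wedge_J1_expansion by (rule refl)
  then show "J2 (gl_wedge A B) v = wedge_field (J1 A) (J1 B) v"
    by (simp add: wedge_field_def wedge_minus[of "J1 B v"] flip: scaleR_2)
qed

subsection \<open>The algebraic Schouten bracket\<close>

lemma linear_gl_bracket_left: "linear (\<lambda>A. gl_bracket A B)"
  by (rule linearI)
     (simp_all add: gl_bracket_def vec_eq_iff matrix_matrix_mult_def algebra_simps
       sum.distrib sum_distrib_left)

lemma linear_gl_bracket_right: "linear (gl_bracket A)"
  by (rule linearI)
     (simp_all add: gl_bracket_def vec_eq_iff matrix_matrix_mult_def algebra_simps
       sum.distrib sum_distrib_left)

lemma linear_gl_wedge3:
  "linear (\<lambda>A. gl_wedge3 A B C)" "linear (\<lambda>B. gl_wedge3 A B C)" "linear (\<lambda>C. gl_wedge3 A B C)"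
  by (auto intro!: linearI simp: gl_wedge3_def vec_eq_iff algebra_simps)

text \<open>Transfers linearity from the first and third arguments to the second and fourth, and
  accounts for the factor 1/4 in \<open>gl_schouten\<close>.\<close>

lemma gl_schouten_wedge_skew:
  "gl_schouten_wedge B A C D = - gl_schouten_wedge A B C D"
  "gl_schouten_wedge A B D C = - gl_schouten_wedge A B C D"
  by (simp_all add: gl_schouten_wedge_def)

lemma linear_gl_schouten_wedge:
  fixes A B C D :: "real^'n^'n"
  shows "linear (\<lambda>A. gl_schouten_wedge A B C D)" "linear (\<lambda>B. gl_schouten_wedge A B C D)"
  "linear (\<lambda>C. gl_schouten_wedge A B C D)" "linear (\<lambda>D. gl_schouten_wedge A B C D)"
proof -
  have b: "linear (\<lambda>A. gl_wedge3 (gl_bracket A C) B D)" "linear (\<lambda>C. gl_wedge3 (gl_bracket A C) B D)"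
    for A B C D :: "real^'n^'n"
    using linear_compose[OF linear_gl_bracket_left linear_gl_wedge3(1)]
      linear_compose[OF linear_gl_bracket_right linear_gl_wedge3(1)]
    by (simp_all add: o_def)
  have A: "linear (\<lambda>A. gl_schouten_wedge A B C D)" and C: "linear (\<lambda>C. gl_schouten_wedge A B C D)"
    for A B C D :: "real^'n^'n"
    unfolding gl_schouten_wedge_def
    by (intro linear_compose_add linear_compose_sub b linear_gl_wedge3)+
  show "linear (\<lambda>A. gl_schouten_wedge A B C D)" "linear (\<lambda>C. gl_schouten_wedge A B C D)"
    by (fact A C)+
  show "linear (\<lambda>B. gl_schouten_wedge A B C D)"
    using linear_compose_neg[OF A[of A C D]] by (simp flip: gl_schouten_wedge_skew(1))
  show "linear (\<lambda>D. gl_schouten_wedge A B C D)"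
    using linear_compose_neg[OF C[of A B C]] by (simp flip: gl_schouten_wedge_skew(2))
qed

lemma gl_schouten_wedge_expansion:
  "(\<Sum>i\<in>UNIV. \<Sum>j\<in>UNIV. \<Sum>k\<in>UNIV. \<Sum>l\<in>UNIV. \<Sum>i'\<in>UNIV. \<Sum>j'\<in>UNIV. \<Sum>k'\<in>UNIV. \<Sum>l'\<in>UNIV.
     ((A$i$j * B$k$l) * (C$i'$j' * D$k'$l')) *\<^sub>R
       gl_schouten_wedge (elem_mat i j) (elem_mat k l) (elem_mat i' j') (elem_mat k' l'))
   = gl_schouten_wedge A B C D"
  unfolding linear_elem_mat_expansion[OF linear_gl_schouten_wedge(1), where A = A]
  unfolding linear_elem_mat_expansion[OF linear_gl_schouten_wedge(2), where A = B]
  unfolding linear_elem_mat_expansion[OF linear_gl_schouten_wedge(3), where A = C]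
  unfolding linear_elem_mat_expansion[OF linear_gl_schouten_wedge(4), where A = D]
  by (simp only: scaleR_sum_right scaleR_scaleR mult.assoc)

text \<open>Each \<open>gl_wedge\<close> is a difference of two tensors; by skew-symmetry the four
  resulting terms are equal once their signs are included.\<close>

lemma gl_schouten_gl_wedge:
  "gl_schouten (gl_wedge A B) (gl_wedge C D) = gl_schouten_wedge A B C D"
proof -
  have "gl_schouten (gl_wedge A B) (gl_wedge C D) = (1/4) *\<^sub>R
     (gl_schouten_wedge A B C D - gl_schouten_wedge B A C D
      - (gl_schouten_wedge A B D C - gl_schouten_wedge B A D C))"
    unfolding gl_schouten_def gl_wedge_def vec_lambda_beta scaleR_left_diff_distrib
      left_diff_distrib right_diff_distrib sum_subtractf gl_schouten_wedge_expansion
    by (rule refl)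
  also have "\<dots> = (1/4) *\<^sub>R (4 *\<^sub>R gl_schouten_wedge A B C D)"
    by (simp add: gl_schouten_wedge_skew[of B A] gl_schouten_wedge_skew(2)[of A B D C]
      scaleR_add_left[of 1 3, simplified] scaleR_add_left[of 1 2, simplified] scaleR_2)
  finally show ?thesis by simp
qed

lemma bilinear_gl_schouten: "bilinear gl_schouten"
  unfolding bilinear_def
  by (intro allI conjI linearI;
      simp only: gl_schouten_def vector_add_component vector_scaleR_component real_scaleR_def
        distrib_left distrib_right scaleR_left_distrib sum.distrib scaleR_right_distrib
        scaleR_sum_right scaleR_scaleR mult_ac)

section \<open>Commuting matrices give SRMI tensors\<close>

lemma sn_bivec_vec_add_field:
  assumes "\<And>i j. (\<lambda>w. P w $ i $ j) differentiable at v" "\<And>i j. (\<lambda>w. Q w $ i $ j) differentiable at v"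
  shows "sn_bivec_vec (add_field P Q) Y v = sn_bivec_vec P Y v + sn_bivec_vec Q Y v"
  by (simp add: sn_bivec_vec_def add_field_def vec_eq_iff partial_add assms algebra_simps
      flip: sum.distrib)

lemma sn_bivec_vec_scale_field:
  assumes "\<And>i j. (\<lambda>w. P w $ i $ j) differentiable at v"
  shows "sn_bivec_vec (scale_field c P) Y v = c *\<^sub>R sn_bivec_vec P Y v"
  by (simp add: sn_bivec_vec_def scale_field_def vec_eq_iff partial_mult assms algebra_simps
      sum_distrib_left)

lemma differentiable_wedge_field_J1: "(\<lambda>w. wedge_field (J1 A) (J1 B) w $ i $ j) differentiable at v"
  by (simp add: wedge_field_def wedge_def)

lemma wedge_comb_eq:
  "wedge_comb X Y Z \<alpha> \<beta> \<gamma> = add_field (add_field (scale_field \<alpha> (wedge_field Y Z))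
     (scale_field \<beta> (wedge_field Z X))) (scale_field \<gamma> (wedge_field X Y))"
  by (simp add: fun_eq_iff wedge_comb_def add_field_def scale_field_def)

text \<open>By linearity and the derivation rule, every term of the bracket contains one of the
  vanishing brackets with \<open>D\<close>.\<close>

lemma sn_bivec_vec_wedge_comb_J1:
  assumes "gl_bracket A D = 0" "gl_bracket B D = 0" "gl_bracket C D = 0"
  shows "sn_bivec_vec (wedge_comb (J1 A) (J1 B) (J1 C) \<alpha> \<beta> \<gamma>) (J1 D) v = 0"
proof -
  have d: "(\<lambda>w. scale_field c (wedge_field (J1 A) (J1 B)) w $ i $ j) differentiable at v"
    for A B :: "real^'a^'a" and c i j v
    by (simp add: scale_field_def differentiable_wedge_field_J1)
  have d': "(\<lambda>w. add_field P Q w $ i $ j) differentiable at v"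
    if "\<And>i j. (\<lambda>w. P w $ i $ j) differentiable at v" "\<And>i j. (\<lambda>w. Q w $ i $ j) differentiable at v"
    for P Q :: "real^'a \<Rightarrow> real^'a^'a" and i j v
    using that by (simp add: add_field_def)
  show ?thesis
    unfolding wedge_comb_eq
    by (simp add: sn_bivec_vec_add_field sn_bivec_vec_scale_field d d'
        differentiable_wedge_field_J1 sn_bivec_vec_wedge_field assms
        linear_0[OF linear_J1_matrix] linear_0[OF linear_wedge_left] linear_0[OF linear_wedge_right])
qed

lemma gl_bracket_self [simp]: "gl_bracket A A = 0"
  by (simp add: gl_bracket_def)

lemma gl_bracket_skew: "gl_bracket B A = - gl_bracket A B"
  by (simp add: gl_bracket_def)

lemma gl_wedge3_zero [simp]: "gl_wedge3 0 B C = 0"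
  by (rule linear_0[OF linear_gl_wedge3(1)])

text \<open>Bilinearity reduces the bracket to decomposable bivectors, where each summand of
  \<open>gl_schouten_wedge\<close> contains a bracket of two of the commuting matrices.\<close>

lemma classical_r_matrix_abelian:
  assumes "gl_bracket A B = 0" "gl_bracket B C = 0" "gl_bracket C A = 0"
  shows "classical_r_matrix (\<alpha> *\<^sub>R gl_wedge B C + \<beta> *\<^sub>R gl_wedge C A + \<gamma> *\<^sub>R gl_wedge A B)"
proof -
  have comm: "gl_bracket B A = 0" "gl_bracket C B = 0" "gl_bracket A C = 0"
    using assms gl_bracket_skew by (metis neg_0_equal_iff_equal)+
  have "gl_schouten (\<alpha> *\<^sub>R gl_wedge B C + \<beta> *\<^sub>R gl_wedge C A + \<gamma> *\<^sub>R gl_wedge A B)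
    (\<alpha> *\<^sub>R gl_wedge B C + \<beta> *\<^sub>R gl_wedge C A + \<gamma> *\<^sub>R gl_wedge A B) = 0"
    by (simp add: bilinear_ladd[OF bilinear_gl_schouten] bilinear_radd[OF bilinear_gl_schouten]
        bilinear_lmul[OF bilinear_gl_schouten] bilinear_rmul[OF bilinear_gl_schouten]
        gl_schouten_gl_wedge gl_schouten_wedge_def assms comm)
  then show ?thesis
    unfolding classical_r_matrix_def wedge_square_def
    by (auto intro!: span_add span_scale intro: span_base)
qed

text \<open>One tensor meets all requirements: it is an r-matrix by commutativity, its factors
  stabilize the field it induces, and \<open>J2\<close> sends it to that field.\<close>

lemma srmi_wedge_comb:
  assumes "gl_bracket A B = 0" "gl_bracket B C = 0" "gl_bracket C A = 0"
  shows "srmi (wedge_comb (J1 A) (J1 B) (J1 C) \<alpha> \<beta> \<gamma>)" (is "srmi ?P")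
proof -
  have comm: "gl_bracket B A = 0" "gl_bracket C B = 0" "gl_bracket A C = 0"
    using assms gl_bracket_skew by (metis neg_0_equal_iff_equal)+
  have "A \<in> stabilizer ?P" "B \<in> stabilizer ?P" "C \<in> stabilizer ?P"
    by (simp_all add: stabilizer_def sn_bivec_vec_wedge_comb_J1 assms comm)
  then have "\<alpha> *\<^sub>R gl_wedge B C + \<beta> *\<^sub>R gl_wedge C A + \<gamma> *\<^sub>R gl_wedge A B \<in> wedge_square (stabilizer ?P)"
    unfolding wedge_square_def by (intro span_add span_scale span_base) auto
  moreover have "?P = J2 (\<alpha> *\<^sub>R gl_wedge B C + \<beta> *\<^sub>R gl_wedge C A + \<gamma> *\<^sub>R gl_wedge A B)"
    by (simp add: J2_add J2_scale J2_gl_wedge wedge_comb_eq)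
  ultimately show ?thesis
    unfolding srmi_def using classical_r_matrix_abelian[OF assms] by blast
qed

section \<open>Criteria for failing SRMI and for small stabilizers\<close>

text \<open>The tensors \<open>r\<close> with \<open>\<phi> (J2 r) = 0\<close> form a subspace.
  Containing the generators of \<open>wedge_square (stabilizer P)\<close>, it contains every
  candidate for inducing \<open>P\<close>.\<close>

lemma not_srmiI:
  fixes \<phi> :: "(real^'n \<Rightarrow> real^'n^'n) \<Rightarrow> real"
  assumes add: "\<And>Q R. \<phi> (add_field Q R) = \<phi> Q + \<phi> R"
    and scale: "\<And>c Q. \<phi> (scale_field c Q) = c * \<phi> Q"
    and wedge: "\<And>A B. A \<in> stabilizer P \<Longrightarrow> B \<in> stabilizer P \<Longrightarrow> \<phi> (wedge_field (J1 A) (J1 B)) = 0"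
    and nz: "\<phi> P \<noteq> 0"
  shows "\<not> srmi P"
proof
  assume "srmi P"
  then obtain r where r: "r \<in> wedge_square (stabilizer P)" "P = J2 r"
    unfolding srmi_def by blast
  have "\<phi> (J2 0) = 0"
    using scale[of 0 "J2 0"] J2_scale[of 0 "0 :: 'n gl_bivector"] by simp
  then have "subspace {r. \<phi> (J2 r) = 0}"
    by (auto simp: subspace_def J2_add J2_scale add scale)
  with r(1) have "\<phi> (J2 r) = 0"
    unfolding wedge_square_def by (rule span_induct) (auto simp: J2_gl_wedge wedge)
  with r(2) nz show False by simp
qed

text \<open>Only an upper bound is claimed, so the spanning matrices may be dependent; classes 8 and
  10 use 0 as the third one.\<close>

lemma dim_le_3I:
  assumes "\<And>A. A \<in> S \<Longrightarrow> \<exists>c1 c2 c3. A = c1 *\<^sub>R M1 + c2 *\<^sub>R M2 + c3 *\<^sub>R M3"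
  shows "dim (S :: 'a::euclidean_space set) \<le> 3"
proof -
  have "S \<subseteq> span {M1, M2, M3}"
    using assms by (force intro!: span_add span_scale intro: span_base)
  then have "dim S \<le> card {M1, M2, M3}"
    by (rule dim_le_card) simp
  also have "\<dots> \<le> 3"
    by (simp add: card_insert_if)
  finally show ?thesis .
qed

subsection \<open>Bivector fields on three-dimensional space\<close>

lemma bivec_component [simp]:
  "bivec p q r $ 1 $ 1 = 0" "bivec p q r $ 1 $ 2 = r" "bivec p q r $ 1 $ 3 = - q"
  "bivec p q r $ 2 $ 1 = - r" "bivec p q r $ 2 $ 2 = 0" "bivec p q r $ 2 $ 3 = p"
  "bivec p q r $ 3 $ 1 = q" "bivec p q r $ 3 $ 2 = - p" "bivec p q r $ 3 $ 3 = 0"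
  by (simp_all add: bivec_def wedge_def axis_def)

lemma vec3_component [simp]: "vec3 x y z $ 1 = x" "vec3 x y z $ 2 = y" "vec3 x y z $ 3 = z"
  by (simp_all add: vec3_def axis_def)

lemma xyz_eq: "xyz f = (\<lambda>v. f (v$1) (v$2) (v$3))"
  by (simp add: fun_eq_iff xyz_def)

lemma J1_3:
  fixes A :: "real^3^3"
  shows "J1 A v $ j = A$1$j * v$1 + A$2$j * v$2 + A$3$j * v$3"
  by (simp add: J1_component sum_3)

text \<open>Trivectors of three-space have a single component. With \<open>F = (p, q, r)\<close> and
  \<open>F' = (p', q', r')\<close> read as vector fields, it vanishes if
  \<open>F . curl F' + F' . curl F = 0\<close>.\<close>

lemma sn_bivec_bivec_bivec:
  assumes d: "p differentiable at v" "q differentiable at v" "r differentiable at v"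
    "p' differentiable at v" "q' differentiable at v" "r' differentiable at v"
    and eq: "p v * (partial 2 r' v - partial 3 q' v) + q v * (partial 3 p' v - partial 1 r' v)
      + r v * (partial 1 q' v - partial 2 p' v)
      + p' v * (partial 2 r v - partial 3 q v) + q' v * (partial 3 p v - partial 1 r v)
      + r' v * (partial 1 q v - partial 2 p v) = 0"
  shows "sn_bivec_bivec (\<lambda>v. bivec (p v) (q v) (r v)) (\<lambda>v. bivec (p' v) (q' v) (r' v)) v = 0"
  using eq
  by (simp add: vec_eq_iff forall_3 sn_bivec_bivec_def sum_3 partial_minus d)
     (simp add: algebra_simps)

lemma homogeneous_quadratic_minus:
  assumes "homogeneous_quadratic f"
  shows "homogeneous_quadratic (\<lambda>v. - f v)"
proof -
  from assms obtain C :: "real^'a^'a" where C: "\<And>v. f v = (\<Sum>k\<in>UNIV. \<Sum>l\<in>UNIV. C$k$l * v$k * v$l)"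
    unfolding homogeneous_quadratic_def by blast
  show ?thesis
    unfolding homogeneous_quadratic_def by (rule exI[of _ "- C"]) (simp add: C sum_negf)
qed

lemma homogeneous_quadratic_zero: "homogeneous_quadratic (\<lambda>v. 0)"
  unfolding homogeneous_quadratic_def by (rule exI[of _ 0]) simp

text \<open>Polarization: the coefficients of a quadratic form are determined by its values at the
  basis vectors and their pairwise sums, so the witness is computed from \<open>f\<close>
  itself.\<close>

lemma homogeneous_quadratic_3I:
  fixes f :: "real^3 \<Rightarrow> real"
  assumes "\<And>v. f v = f (axis 1 1) * (v$1)\<^sup>2 + f (axis 2 1) * (v$2)\<^sup>2 + f (axis 3 1) * (v$3)\<^sup>2
    + (f (axis 1 1 + axis 2 1) - f (axis 1 1) - f (axis 2 1)) * (v$1 * v$2)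
    + (f (axis 2 1 + axis 3 1) - f (axis 2 1) - f (axis 3 1)) * (v$2 * v$3)
    + (f (axis 1 1 + axis 3 1) - f (axis 1 1) - f (axis 3 1)) * (v$1 * v$3)"
  shows "homogeneous_quadratic f"
  unfolding homogeneous_quadratic_def
proof (intro exI allI)
  fix v
  let ?C = "vector [
       vector [f (axis 1 1), f (axis 1 1 + axis 2 1) - f (axis 1 1) - f (axis 2 1),
         f (axis 1 1 + axis 3 1) - f (axis 1 1) - f (axis 3 1)],
       vector [0, f (axis 2 1), f (axis 2 1 + axis 3 1) - f (axis 2 1) - f (axis 3 1)],
       vector [0, 0, f (axis 3 1)]] :: real^3^3"
  show "f v = (\<Sum>k\<in>UNIV. \<Sum>l\<in>UNIV. ?C$k$l * v$k * v$l)"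
    by (subst assms) (simp add: sum_3 power2_eq_square)
qed

text \<open>The Jacobi identity becomes the integrability condition \<open>F . curl F = 0\<close>
  for \<open>F = (p, q, r)\<close>.\<close>

lemma quadratic_poisson_bivecI:
  assumes "homogeneous_quadratic p" "homogeneous_quadratic q" "homogeneous_quadratic r"
    and "\<And>v. p differentiable at v" "\<And>v. q differentiable at v" "\<And>v. r differentiable at v"
    and eq: "\<And>v. p v * (partial 2 r v - partial 3 q v) + q v * (partial 3 p v - partial 1 r v)
      + r v * (partial 1 q v - partial 2 p v) = 0"
  shows "quadratic_poisson (\<lambda>v. bivec (p v) (q v) (r v))"
  unfolding quadratic_poisson_def
proof (intro conjI allI)
  show "transpose (bivec (p v) (q v) (r v)) = - bivec (p v) (q v) (r v)" for v
    by (simp add: vec_eq_iff forall_3 transpose_def)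
  show "homogeneous_quadratic (\<lambda>v. bivec (p v) (q v) (r v) $ i $ j)" for i j
    using exhaust_3[of i] exhaust_3[of j]
    by (auto simp: assms homogeneous_quadratic_minus homogeneous_quadratic_zero)
  show "sn_bivec_bivec (\<lambda>v. bivec (p v) (q v) (r v)) (\<lambda>v. bivec (p v) (q v) (r v)) v = 0" for v
    using eq[of v] by (intro sn_bivec_bivec_bivec assms) (simp add: algebra_simps)
qed

section \<open>Coordinate forms of the five families and splittings of the classes\<close>

lemma comb_A_eq: "comb_A \<alpha> \<beta> \<gamma> = (\<lambda>v. bivec (\<alpha> * v$2 * v$3) (\<beta> * v$1 * v$3) (\<gamma> * v$1 * v$2))"
  by (simp add: comb_A_def wedge_comb_def wedge_field_def wedge_def xyz_def fun_eq_iff vec_eq_iff forall_3)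

lemma comb_B_eq: "comb_B \<alpha> \<beta> \<gamma> = (\<lambda>v. bivec ((\<alpha> * v$1 - \<beta> * v$2) * v$3) ((\<beta> * v$1 + \<alpha> * v$2) * v$3)
    (\<gamma> * ((v$1)\<^sup>2 + (v$2)\<^sup>2)))"
  by (simp add: comb_B_def wedge_comb_def wedge_field_def wedge_def xyz_def fun_eq_iff vec_eq_iff
      forall_3 algebra_simps power2_eq_square)

lemma comb_C_eq: "comb_C \<alpha> \<beta> \<gamma> = (\<lambda>v. bivec ((\<alpha> * v$1 - \<beta> * v$2) * v$3) (\<beta> * v$1 * v$3) (\<gamma> * (v$1)\<^sup>2))"
  by (simp add: comb_C_def wedge_comb_def wedge_field_def wedge_def xyz_def fun_eq_iff vec_eq_iff
      forall_3 algebra_simps power2_eq_square)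

lemma comb_D_eq: "comb_D \<alpha> \<beta> \<gamma> = (\<lambda>v. bivec (\<alpha> * (v$1)\<^sup>2 - \<beta> * v$1 * v$2 + \<gamma> * ((v$2)\<^sup>2 - v$1 * v$3))
    (\<beta> * (v$1)\<^sup>2 - \<gamma> * v$1 * v$2) (\<gamma> * (v$1)\<^sup>2))"
  by (simp add: comb_D_def wedge_comb_def wedge_field_def wedge_def xyz_def fun_eq_iff vec_eq_iff
      forall_3 algebra_simps power2_eq_square)

text \<open>The product of the first two fields contributes \<open>- b * x * z\<close> to the
  23-coefficient, which lowers the \<open>3 * b + 1\<close> of the third field to
  \<open>2 * b + 1\<close>.\<close>

lemma comb_E_eq: "comb_E a b 1 0 b = (\<lambda>v. bivec (a * (v$1)\<^sup>2 + (2 * b + 1) * v$1 * v$3) 0 (b * (v$1)\<^sup>2))"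
  by (simp add: comb_E_def wedge_comb_def wedge_field_def wedge_def xyz_def fun_eq_iff vec_eq_iff
      forall_3 algebra_simps power2_eq_square)

lemma Pi_field_z3: "scale_field k (Pi_field (xyz (\<lambda>x y z. z^3))) = (\<lambda>v. bivec 0 0 (3 * k * (v$3)\<^sup>2))"
  by (simp add: scale_field_def Pi_field_def xyz_eq partial_simps fun_eq_iff vec_eq_iff forall_3)

lemma Pi_field_cubic: "Pi_field (xyz (\<lambda>x y z. c/3 * z^3 + x * z^2)) =
    (\<lambda>v. bivec ((v$3)\<^sup>2) 0 (c * (v$3)\<^sup>2 + 2 * v$1 * v$3))"
  by (simp add: Pi_field_def xyz_eq partial_simps fun_eq_iff vec_eq_iff forall_3)

lemmas comb_eqs = comb_A_eq comb_B_eq comb_C_eq comb_D_eq comb_E_eq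

lemma bivec_eq_iff: "bivec p q r = bivec p' q' r' \<longleftrightarrow> p = p' \<and> q = q' \<and> r = r'"
  by (auto simp: vec_eq_iff forall_3)

lemma bivec_add: "bivec p q r + bivec p' q' r' = bivec (p + p') (q + q') (r + r')"
  by (simp add: vec_eq_iff forall_3)

lemma Lambda_eq_comb:
  "Lambda1 a b c = comb_A a b c"
  "Lambda2 a b = comb_B (2*a) b a"
  "Lambda7 a b c = comb_B (2*a + c) b a"
  "Lambda3 a = comb_C 2 a 1"
  "Lambda5 a = comb_C (2*a + 1) (-1) a"
  "Lambda6 a = comb_C 0 (- a) (- (1/2))"
  "Lambda9 a = comb_D a 0 (- (1/3))"
  by (simp_all add: Lambda1_def Lambda2_def Lambda7_def Lambda3_def Lambda5_def Lambda6_def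
      Lambda9_def comb_eqs xyz_eq fun_eq_iff bivec_eq_iff) (simp_all add: field_simps)

lemma Lambda4_split:
  "Lambda4 a b = add_field (comb_A a a b) (scale_field (1/3) (Pi_field (xyz (\<lambda>x y z. z^3))))"
  unfolding Lambda4_def Pi_field_z3 comb_eqs
  by (simp add: add_field_def bivec_add xyz_eq fun_eq_iff bivec_eq_iff algebra_simps)

lemma Lambda8_split:
  "Lambda8 \<epsilon> a b = add_field (comb_B a 0 ((a + b)/2)) (scale_field (\<epsilon>/3) (Pi_field (xyz (\<lambda>x y z. z^3))))"
  unfolding Lambda8_def Pi_field_z3 comb_eqs
  by (simp add: add_field_def bivec_add xyz_eq fun_eq_iff bivec_eq_iff algebra_simps)

lemma Lambda10_split:
  "Lambda10 a = add_field (comb_D 0 0 (- (2*a + 1))) (xyz (\<lambda>x y z. bivec ((3*a + 1) * (y^2 - 2*x*z)) 0 0))"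
  by (simp add: Lambda10_def comb_eqs add_field_def bivec_add xyz_eq fun_eq_iff bivec_eq_iff algebra_simps)

lemma Lambda11_split:
  "Lambda11 b c = add_field (comb_E 0 b 1 0 b) (scale_field (c/3) (Pi_field (xyz (\<lambda>x y z. z^3))))"
  unfolding Lambda11_def Pi_field_z3 comb_eqs
  by (simp add: add_field_def bivec_add xyz_eq fun_eq_iff bivec_eq_iff algebra_simps)

lemma Lambda12_split:
  "Lambda12 b c = add_field (comb_E 1 b 1 0 b) (scale_field (c/3) (Pi_field (xyz (\<lambda>x y z. z^3))))"
  unfolding Lambda12_def Pi_field_z3 comb_eqs
  by (simp add: add_field_def bivec_add xyz_eq fun_eq_iff bivec_eq_iff algebra_simps)

lemma Lambda13_split:
  "Lambda13 a b c = add_field (comb_E a b 1 0 b) (Pi_field (xyz (\<lambda>x y z. c/3 * z^3 + x * z^2)))"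
  unfolding Lambda13_def Pi_field_cubic comb_eqs
  by (simp add: add_field_def bivec_add xyz_eq fun_eq_iff bivec_eq_iff algebra_simps)

section \<open>Poisson property and compatibility\<close>

lemma quadratic_poisson_comb:
  "quadratic_poisson (comb_A a b c)" "quadratic_poisson (comb_B a b c)"
  "quadratic_poisson (comb_C a b c)" "quadratic_poisson (comb_D a b c)"
  "quadratic_poisson (comb_E a b 1 0 b)"
  unfolding comb_eqs
  by - (intro quadratic_poisson_bivecI homogeneous_quadratic_3I;
        simp add: partial_simps axis_def algebra_simps power2_eq_square)+

lemma quadratic_poisson_remainder:
  "quadratic_poisson (scale_field k (Pi_field (xyz (\<lambda>x y z. z^3))))"
  "quadratic_poisson (Pi_field (xyz (\<lambda>x y z. c/3 * z^3 + x * z^2)))"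
  "quadratic_poisson (xyz (\<lambda>x y z. bivec (k * (y^2 - 2*x*z)) 0 0))"
  unfolding Pi_field_z3 Pi_field_cubic unfolding xyz_eq
  by - (intro quadratic_poisson_bivecI homogeneous_quadratic_3I;
        simp add: partial_simps axis_def algebra_simps power2_eq_square)+

lemma quadratic_poisson_Lambda:
  "quadratic_poisson (Lambda4 a b)" "quadratic_poisson (Lambda8 \<epsilon> a b)"
  "quadratic_poisson (Lambda10 a)" "quadratic_poisson (Lambda11 b c)"
  "quadratic_poisson (Lambda12 b c)" "quadratic_poisson (Lambda13 a b c)"
  unfolding Lambda4_def Lambda8_def Lambda10_def Lambda11_def Lambda12_def Lambda13_def xyz_eq
  by - (intro quadratic_poisson_bivecI homogeneous_quadratic_3I;
        simp add: partial_simps axis_def field_simps power2_eq_square)+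

text \<open>A remainder of the form \<open>Pi_field f\<close> is a gradient, hence curl-free, and
  only its product with the curl of the combination is left. For \<open>z^3\<close> this is a
  multiple of \<open>partial 1 q - partial 2 p\<close>, which vanishes because the first two
  coefficients agree in family A and the second is 0 in family B; in family E, \<open>q\<close> is 0
  and \<open>p\<close> is free of \<open>y\<close>.\<close>

lemma compatible_split:
  "compatible (comb_A a a b) (scale_field k (Pi_field (xyz (\<lambda>x y z. z^3))))"
  "compatible (comb_B a 0 b) (scale_field k (Pi_field (xyz (\<lambda>x y z. z^3))))"
  "compatible (comb_D 0 0 b) (xyz (\<lambda>x y z. bivec (k * (y^2 - 2*x*z)) 0 0))"
  "compatible (comb_E a b 1 0 b) (scale_field k (Pi_field (xyz (\<lambda>x y z. z^3))))"
  "compatible (comb_E a b 1 0 b) (Pi_field (xyz (\<lambda>x y z. c/3 * z^3 + x * z^2)))"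
  unfolding compatible_def Pi_field_z3 Pi_field_cubic comb_eqs unfolding xyz_eq
  by - (intro allI sn_bivec_bivec_bivec;
        simp add: partial_simps algebra_simps power2_eq_square)+

subsection \<open>Stabilizers\<close>

text \<open>A skew matrix has three independent entries; the equations are those of the components
  23, 31 and 12, in this order.\<close>

lemma stabilizer_bivec:
  assumes "A \<in> stabilizer (\<lambda>v. bivec (p v) (q v) (r v))"
    and d: "p differentiable at v" "q differentiable at v" "r differentiable at v"
  shows "p v * (A$2$2 + A$3$3) - q v * A$1$2 - r v * A$1$3
      - (J1 A v $ 1 * partial 1 p v + J1 A v $ 2 * partial 2 p v + J1 A v $ 3 * partial 3 p v) = 0"
    and "q v * (A$3$3 + A$1$1) - r v * A$2$3 - p v * A$2$1
      - (J1 A v $ 1 * partial 1 q v + J1 A v $ 2 * partial 2 q v + J1 A v $ 3 * partial 3 q v) = 0"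
    and "r v * (A$1$1 + A$2$2) - p v * A$3$1 - q v * A$3$2
      - (J1 A v $ 1 * partial 1 r v + J1 A v $ 2 * partial 2 r v + J1 A v $ 3 * partial 3 r v) = 0"
proof -
  let ?S = "sn_bivec_vec (\<lambda>v. bivec (p v) (q v) (r v)) (J1 A) v"
  have "?S = 0"
    using assms(1) by (simp add: stabilizer_def)
  then have S: "?S $ 2 $ 3 = 0" "?S $ 3 $ 1 = 0" "?S $ 1 $ 2 = 0"
    by simp_all
  show "p v * (A$2$2 + A$3$3) - q v * A$1$2 - r v * A$1$3
      - (J1 A v $ 1 * partial 1 p v + J1 A v $ 2 * partial 2 p v + J1 A v $ 3 * partial 3 p v) = 0"
    using S(1) by (simp add: sn_bivec_vec_def sum_3 algebra_simps)
  show "q v * (A$3$3 + A$1$1) - r v * A$2$3 - p v * A$2$1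
      - (J1 A v $ 1 * partial 1 q v + J1 A v $ 2 * partial 2 q v + J1 A v $ 3 * partial 3 q v) = 0"
    using S(2) by (simp add: sn_bivec_vec_def sum_3 algebra_simps)
  show "r v * (A$1$1 + A$2$2) - p v * A$3$1 - q v * A$3$2
      - (J1 A v $ 1 * partial 1 r v + J1 A v $ 2 * partial 2 r v + J1 A v $ 3 * partial 3 r v) = 0"
    using S(3) by (simp add: sn_bivec_vec_def sum_3 algebra_simps)
qed

text \<open>Splits each stabilizer equation, quadratic in the point, into six linear ones for the
  entries of \<open>A\<close>. The order \<open>x^2\<close>, \<open>y^2\<close>, \<open>z^2\<close>,
  \<open>xy\<close>, \<open>yz\<close>, \<open>xz\<close> fixes the numbering of the facts
  \<open>E\<close> below.\<close>

lemma quadratic_form_3_zeroD: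
  fixes c1 :: real
  assumes "\<And>x y z. c1 * x\<^sup>2 + c2 * y\<^sup>2 + c3 * z\<^sup>2 + c4 * (x * y) + c5 * (y * z) + c6 * (x * z) = 0"
  shows "c1 = 0" "c2 = 0" "c3 = 0" "c4 = 0" "c5 = 0" "c6 = 0"
  using assms[of 1 0 0] assms[of 0 1 0] assms[of 0 0 1] assms[of 1 1 0] assms[of 0 1 1] assms[of 1 0 1]
  by simp_all

lemma stabilizer_Lambda4:
  fixes A :: "real^3^3"
  assumes "A \<in> stabilizer (\<lambda>v. bivec (a * v$2 * v$3) (a * v$1 * v$3) (b * v$1 * v$2 + (v$3)\<^sup>2))"
    and "a \<noteq> 0 \<or> b \<noteq> 0"
  shows "A$1$2 = 0" "A$1$3 = 0" "A$2$1 = 0" "A$2$3 = 0" "A$3$1 = 0" "A$3$2 = 0" "A$1$1 = 2*A$3$3 - A$2$2"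
proof -
  note S = stabilizer_bivec[OF assms(1)]
  have p: "\<And>x y z. 0 * x\<^sup>2 + (- a*A$2$3) * y\<^sup>2
      + (- A$1$3 - a*A$3$2) * z\<^sup>2 + (- (a+b)*A$1$3) * (x * y)
      + 0 * (y * z) + (- 2*a*A$1$2) * (x * z) = 0"
    using S(1)[of "vec3 x y z" for x y z]
    by (simp add: partial_simps J1_3 algebra_simps power2_eq_square)
  have q: "\<And>x y z. (- a*A$1$3) * x\<^sup>2 + 0 * y\<^sup>2
      + (- A$2$3 - a*A$3$1) * z\<^sup>2 + (- (a+b)*A$2$3) * (x * y)
      + (- 2*a*A$2$1) * (y * z) + 0 * (x * z) = 0"
    using S(2)[of "vec3 x y z" for x y z]
    by (simp add: partial_simps J1_3 algebra_simps power2_eq_square)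
  have r: "\<And>x y z. (- b*A$1$2) * x\<^sup>2 + (- b*A$2$1) * y\<^sup>2
      + (A$1$1+A$2$2-2*A$3$3) * z\<^sup>2 + 0 * (x * y)
      + (- (a+b)*A$3$1 - 2*A$2$3) * (y * z) + (- (a+b)*A$3$2 - 2*A$1$3) * (x * z) = 0"
    using S(3)[of "vec3 x y z" for x y z]
    by (simp add: partial_simps J1_3 algebra_simps power2_eq_square)
  \<comment> \<open>Facts 1 to 6 come from \<open>\<partial>\<^sub>2\<^sub>3\<close>, 7 to 12 from \<open>\<partial>\<^sub>3\<^sub>1\<close>, 13 to 18 from \<open>\<partial>\<^sub>1\<^sub>2\<close>.\<close>
  note E = quadratic_form_3_zeroD[OF p] quadratic_form_3_zeroD[OF q] quadratic_form_3_zeroD[OF r]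
  \<comment> \<open>Each off-diagonal entry is killed by two equations whose factors,
    \<open>a\<close> and \<open>b\<close> or \<open>a\<close> and \<open>a + b\<close>, cannot both
    vanish. \<open>A$3$1\<close> and \<open>A$3$2\<close> come last, since \<open>A$2$3\<close> and
    \<open>A$1$3\<close> occur in their equations.\<close>
  have z12: "A$1$2 = 0"
    using assms(2) E(6,13) by auto
  have z13: "A$1$3 = 0"
    using assms(2) E(4,7) by auto
  have z21: "A$2$1 = 0"
    using assms(2) E(11,14) by auto
  have z23: "A$2$3 = 0"
    using assms(2) E(2,10) by auto
  have z31: "A$3$1 = 0"
    using assms(2) E(9,17) z23 by auto
  have z32: "A$3$2 = 0"
    using assms(2) E(3,18) z13 by auto
  have z11: "A$1$1 = 2*A$3$3 - A$2$2"
    using E(15) by simp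
  show "A$1$2 = 0" "A$1$3 = 0" "A$2$1 = 0" "A$2$3 = 0" "A$3$1 = 0" "A$3$2 = 0" "A$1$1 = 2*A$3$3 - A$2$2"
    by (fact z12 z13 z21 z23 z31 z32 z11)+
qed

text \<open>Here \<open>k\<close> stands for \<open>(a + b)/2\<close>. The conclusion confines the
  stabilizer to the span of the Euler field and the rotation in the \<open>xy\<close>-plane.\<close>

lemma stabilizer_Lambda8:
  fixes A :: "real^3^3"
  assumes "A \<in> stabilizer (\<lambda>v. bivec (a * v$1 * v$3) (a * v$2 * v$3) (k * ((v$1)\<^sup>2 + (v$2)\<^sup>2) + \<epsilon> * (v$3)\<^sup>2))"
    and "a \<noteq> 0 \<or> k \<noteq> 0" and "\<epsilon> \<noteq> 0"
  shows "A$1$1 = A$2$2" "A$3$3 = A$2$2" "A$2$1 = - A$1$2" "A$1$3 = 0" "A$2$3 = 0" "A$3$1 = 0" "A$3$2 = 0"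
proof -
  note S = stabilizer_bivec[OF assms(1)]
  have p: "\<And>x y z. (- (k+a)*A$1$3) * x\<^sup>2 + (- k*A$1$3) * y\<^sup>2
      + (- \<epsilon>*A$1$3 - a*A$3$1) * z\<^sup>2 + (- a*A$2$3) * (x * y)
      + (- a*(A$1$2+A$2$1)) * (y * z) + (a*(A$2$2-A$1$1)) * (x * z) = 0"
    using S(1)[of "vec3 x y z" for x y z]
    by (simp add: partial_simps J1_3 algebra_simps power2_eq_square)
  have q: "\<And>x y z. (- k*A$2$3) * x\<^sup>2 + (- (k+a)*A$2$3) * y\<^sup>2
      + (- \<epsilon>*A$2$3 - a*A$3$2) * z\<^sup>2 + (- a*A$1$3) * (x * y)
      + (a*(A$1$1-A$2$2)) * (y * z) + (- a*(A$1$2+A$2$1)) * (x * z) = 0"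
    using S(2)[of "vec3 x y z" for x y z]
    by (simp add: partial_simps J1_3 algebra_simps power2_eq_square)
  have r: "\<And>x y z. (k*(A$2$2-A$1$1)) * x\<^sup>2 + (k*(A$1$1-A$2$2)) * y\<^sup>2
      + (\<epsilon>*(A$1$1+A$2$2-2*A$3$3)) * z\<^sup>2 + (- 2*k*(A$1$2+A$2$1)) * (x * y)
      + (- (a+2*k)*A$3$2-2*\<epsilon>*A$2$3) * (y * z) + (- (a+2*k)*A$3$1-2*\<epsilon>*A$1$3) * (x * z) = 0"
    using S(3)[of "vec3 x y z" for x y z]
    by (simp add: partial_simps J1_3 algebra_simps power2_eq_square)
  note E = quadratic_form_3_zeroD[OF p] quadratic_form_3_zeroD[OF q] quadratic_form_3_zeroD[OF r]
  \<comment> \<open>The paired equations carry factors proportional to \<open>a\<close> and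
    \<open>k\<close>, or \<open>a\<close> and \<open>a + 2 * k\<close>, which cannot both
    vanish.\<close>
  have z11: "A$1$1 = A$2$2"
    using assms(2) E(6,13) by auto
  have z33: "A$3$3 = A$2$2"
    using assms(3) E(15) z11 by simp
  have z21: "A$2$1 = - A$1$2"
    using assms(2) E(5,16) by (auto simp: add_eq_0_iff)
  have z13: "A$1$3 = 0"
    using assms(2) E(2,10) by auto
  have z23: "A$2$3 = 0"
    using assms(2) E(4,7) by auto
  have z31: "A$3$1 = 0"
    using assms(2) E(3,18) z13 by auto
  have z32: "A$3$2 = 0"
    using assms(2) E(9,17) z23 by auto
  show "A$1$1 = A$2$2" "A$3$3 = A$2$2" "A$2$1 = - A$1$2" "A$1$3 = 0" "A$2$3 = 0" "A$3$1 = 0" "A$3$2 = 0"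
    by (fact z11 z33 z21 z13 z23 z31 z32)+
qed

text \<open>What remains is spanned by the first two fields of family D.\<close>

lemma stabilizer_Lambda10:
  fixes A :: "real^3^3"
  assumes "A \<in> stabilizer (\<lambda>v. bivec (a * (v$2)\<^sup>2 - (4 * a + 1) * v$1 * v$3)
      ((2 * a + 1) * v$1 * v$2) (- (2 * a + 1) * (v$1)\<^sup>2))"
    and "a \<noteq> - (1/3)"
  shows "A$1$1 = A$2$2" "A$3$3 = A$2$2" "A$1$3 = 0" "A$2$1 = 0" "A$3$1 = 0" "A$3$2 = 0" "A$2$3 = A$1$2"
proof -
  note S = stabilizer_bivec[OF assms(1)]
  have p: "\<And>x y z. ((6*a+2)*A$1$3) * x\<^sup>2 + (a*(A$3$3-A$2$2)) * y\<^sup>2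
      + ((4*a+1)*A$3$1) * z\<^sup>2 + (- (4*a+1)*A$1$2+(4*a+1)*A$2$3) * (x * y)
      + ((4*a+1)*A$2$1-2*a*A$3$2) * (y * z) + ((4*a+1)*(A$1$1-A$2$2)) * (x * z) = 0"
    using S(1)[of "vec3 x y z" for x y z]
    by (simp add: partial_simps J1_3 algebra_simps power2_eq_square)
  have q: "\<And>x y z. ((2*a+1)*(A$2$3-A$1$2)) * x\<^sup>2 + (- (3*a+1)*A$2$1) * y\<^sup>2
      + 0 * z\<^sup>2 + ((2*a+1)*(A$3$3-A$2$2)) * (x * y)
      + (- (2*a+1)*A$3$1) * (y * z) + ((4*a+1)*A$2$1-(2*a+1)*A$3$2) * (x * z) = 0"
    using S(2)[of "vec3 x y z" for x y z]
    by (simp add: partial_simps J1_3 algebra_simps power2_eq_square)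
  have r: "\<And>x y z. ((2*a+1)*(A$1$1-A$2$2)) * x\<^sup>2 + (- a*A$3$1) * y\<^sup>2
      + 0 * z\<^sup>2 + ((2*a+1)*(2*A$2$1-A$3$2)) * (x * y)
      + 0 * (y * z) + ((8*a+3)*A$3$1) * (x * z) = 0"
    using S(3)[of "vec3 x y z" for x y z]
    by (simp add: partial_simps J1_3 algebra_simps power2_eq_square)
  note E = quadratic_form_3_zeroD[OF p] quadratic_form_3_zeroD[OF q] quadratic_form_3_zeroD[OF r]
  \<comment> \<open>Any two of \<open>a\<close>, \<open>2 * a + 1\<close>, \<open>4 * a + 1\<close>
    have no common zero, so paired equations suffice. The assumption on \<open>a\<close> enters
    through \<open>A$1$3\<close> and \<open>A$2$1\<close>, whose equations carry the factor
    \<open>3 * a + 1\<close>.\<close>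
  have z11: "A$1$1 = A$2$2"
    using E(6) E(13) by (cases "4*a+1 = 0") auto
  have z33: "A$3$3 = A$2$2"
    using E(2) E(10) by auto
  have z13: "A$1$3 = 0"
    using assms(2) E(1) by auto
  have z21: "A$2$1 = 0"
    using assms(2) E(8) by auto
  have z31: "A$3$1 = 0"
    using E(3) E(14) by auto
  have z32: "A$3$2 = 0"
    using E(5) E(12) z21 by auto
  have z23: "A$2$3 = A$1$2"
    using E(4) E(7) by (auto simp: algebra_simps)
  show "A$1$1 = A$2$2" "A$3$3 = A$2$2" "A$1$3 = 0" "A$2$1 = 0" "A$3$1 = 0" "A$3$2 = 0" "A$2$3 = A$1$2"
    by (fact z11 z33 z13 z21 z31 z32 z23)+
qed

text \<open>The three classes of family E are \<open>(d, e, f) = (0, 0, 0), (1, 0, 0), (a, 1, 2)\<close>.\<close>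

lemma stabilizer_family_E:
  fixes A :: "real^3^3"
  assumes "A \<in> stabilizer (\<lambda>v. bivec (d * (v$1)\<^sup>2 + (2 * b + 1) * v$1 * v$3 + e * (v$3)\<^sup>2) 0
      (b * (v$1)\<^sup>2 + c * (v$3)\<^sup>2 + f * v$1 * v$3))"
    and "e = 0 \<and> f = 0 \<and> c \<noteq> 0 \<or> e = 1 \<and> f = 2"
  shows "A$1$1 = A$2$2" "A$3$3 = A$2$2" "A$1$3 = 0" "A$2$1 = 0" "A$2$3 = 0" "A$3$1 = 0"
proof -
  note S = stabilizer_bivec[OF assms(1)]
  have p: "\<And>x y z. (d*(A$2$2+A$3$3-2*A$1$1)-(3*b+1)*A$1$3) * x\<^sup>2 + 0 * y\<^sup>2
      + (e*(A$2$2-A$3$3)-c*A$1$3-(2*b+1)*A$3$1) * z\<^sup>2 + (- 2*d*A$2$1-(2*b+1)*A$2$3) * (x * y)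
      + (- (2*b+1)*A$2$1-2*e*A$2$3) * (y * z) + ((2*b+1)*(A$2$2-A$1$1)-(f+2*e)*A$1$3-2*d*A$3$1) * (x * z) = 0"
    using S(1)[of "vec3 x y z" for x y z]
    by (simp add: partial_simps J1_3 algebra_simps power2_eq_square)
  have q: "\<And>x y z. (- b*A$2$3-d*A$2$1) * x\<^sup>2 + 0 * y\<^sup>2
      + (- c*A$2$3-e*A$2$1) * z\<^sup>2 + 0 * (x * y)
      + 0 * (y * z) + (- f*A$2$3-(2*b+1)*A$2$1) * (x * z) = 0"
    using S(2)[of "vec3 x y z" for x y z]
    by (simp add: partial_simps J1_3 algebra_simps power2_eq_square)
  have r: "\<And>x y z. (b*(A$2$2-A$1$1)-d*A$3$1-f*A$1$3) * x\<^sup>2 + 0 * y\<^sup>2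
      + (c*(A$1$1+A$2$2-2*A$3$3)-(e+f)*A$3$1) * z\<^sup>2 + (- 2*b*A$2$1-f*A$2$3) * (x * y)
      + (- f*A$2$1-2*c*A$2$3) * (y * z) + (f*(A$2$2-A$3$3)-(4*b+1)*A$3$1-2*c*A$1$3) * (x * z) = 0"
    using S(3)[of "vec3 x y z" for x y z]
    by (simp add: partial_simps J1_3 algebra_simps power2_eq_square)
  note E = quadratic_form_3_zeroD[OF p] quadratic_form_3_zeroD[OF q] quadratic_form_3_zeroD[OF r]
  \<comment> \<open>In both cases \<open>f = 2 * e\<close>, so \<open>E(18)\<close> minus twice
    \<open>E(3)\<close> leaves exactly \<open>A$3$1\<close>, whatever \<open>b\<close> is.\<close>
  have z31: "A$3$1 = 0"
    using assms(2) E(3,18) by (auto simp: algebra_simps)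
  have z11: "A$1$1 = A$2$2"
  proof -
    \<comment> \<open>\<open>E(6)\<close> minus twice \<open>E(13)\<close> eliminates
      \<open>b\<close> and \<open>d\<close>; the last term vanishes because
      \<open>f = 2 * e\<close>.\<close>
    have "A$2$2 - A$1$1 = ((2*b+1)*(A$2$2-A$1$1)-(f+2*e)*A$1$3-2*d*A$3$1)
        - 2 * (b*(A$2$2-A$1$1)-d*A$3$1-f*A$1$3) + (2*e-f)*A$1$3"
      by (simp add: algebra_simps)
    then show ?thesis
      using assms(2) unfolding E(6,13) by auto
  qed
  \<comment> \<open>\<open>E(3)\<close> settles the case \<open>e = 0\<close>,
    \<open>c \<noteq> 0\<close>, and \<open>E(13)\<close> the case \<open>f = 2\<close>.\<close>
  have z13: "A$1$3 = 0"
    using assms(2) E(3,13) z31 z11 by auto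
  have z33: "A$3$3 = A$2$2"
    using assms(2) E(3,15) z31 z13 z11 by (auto simp: algebra_simps)
  \<comment> \<open>\<open>E(12)\<close> and \<open>E(16)\<close> differ by \<open>A$2$1\<close>,
    since their factors are \<open>2 * b + 1\<close> and \<open>2 * b\<close>.\<close>
  have z21: "A$2$1 = 0"
    using assms(2) E(9,12,16) by (auto simp: algebra_simps)
  have z23: "A$2$3 = 0"
    using assms(2) E(9,16) z21 by (auto simp: algebra_simps)
  show "A$1$1 = A$2$2" "A$3$3 = A$2$2" "A$1$3 = 0" "A$2$1 = 0" "A$2$3 = 0" "A$3$1 = 0"
    by (fact z31 z13 z11 z33 z21 z23)+
qed

section \<open>Obstructions and dimension bounds, class by class\<close>

lemma Lambda11_13_eq:
  "Lambda11 b c = (\<lambda>v. bivec (0 * (v$1)\<^sup>2 + (2 * b + 1) * v$1 * v$3 + 0 * (v$3)\<^sup>2) 0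
      (b * (v$1)\<^sup>2 + c * (v$3)\<^sup>2 + 0 * v$1 * v$3))"
  "Lambda12 b c = (\<lambda>v. bivec (1 * (v$1)\<^sup>2 + (2 * b + 1) * v$1 * v$3 + 0 * (v$3)\<^sup>2) 0
      (b * (v$1)\<^sup>2 + c * (v$3)\<^sup>2 + 0 * v$1 * v$3))"
  "Lambda13 a b c = (\<lambda>v. bivec (a * (v$1)\<^sup>2 + (2 * b + 1) * v$1 * v$3 + 1 * (v$3)\<^sup>2) 0
      (b * (v$1)\<^sup>2 + c * (v$3)\<^sup>2 + 2 * v$1 * v$3))"
  by (simp_all add: Lambda11_def Lambda12_def Lambda13_def xyz_eq)

text \<open>
  In the next lemmas the functional \<open>\<phi>\<close> reads off coefficients from values at suitable points: that of
  \<open>z\<^sup>2 \<partial>\<^sub>1\<^sub>2\<close> for \<open>\<Lambda>\<^sub>4\<close>, \<open>\<Lambda>\<^sub>8\<close>, \<open>\<Lambda>\<^sub>1\<^sub>1\<close> and \<open>\<Lambda>\<^sub>1\<^sub>2\<close>, the sum of those of \<open>xz \<partial>\<^sub>2\<^sub>3\<close> and \<open>y\<^sup>2 \<partial>\<^sub>2\<^sub>3\<close>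
  for \<open>\<Lambda>\<^sub>1\<^sub>0\<close>, and the sum of those of \<open>xz \<partial>\<^sub>1\<^sub>2\<close> and \<open>z\<^sup>2 \<partial>\<^sub>2\<^sub>3\<close> for \<open>\<Lambda>\<^sub>1\<^sub>3\<close>.
\<close>

lemma Lambda4_obstruction:
  assumes "a \<noteq> 0 \<or> b \<noteq> 0"
  shows "\<not> srmi (Lambda4 a b)" "dim (stabilizer (Lambda4 a b)) \<le> 3"
proof -
  note S = stabilizer_Lambda4[OF _ assms]
  show "\<not> srmi (Lambda4 a b)"
    unfolding Lambda4_def xyz_eq
    \<comment> \<open>At \<open>(0, 0, 1)\<close> all stabilizing fields point along the third axis,
      so their wedge products have no 12-coefficient, while that of the tensor is 1.\<close>
    by (rule not_srmiI[where \<phi> = "\<lambda>Q. Q (vec3 0 0 1) $ 1 $ 2"])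
       (simp_all add: add_field_def scale_field_def wedge_field_def wedge_def J1_3 S)
  show "dim (stabilizer (Lambda4 a b)) \<le> 3"
    unfolding Lambda4_def xyz_eq
  proof (rule dim_le_3I)
    fix A assume "A \<in> stabilizer (\<lambda>v::real^3. bivec (a * v$2 * v$3) (a * v$1 * v$3) (b * v$1 * v$2 + (v$3)\<^sup>2))"
    from S[OF this] show "\<exists>c1 c2 c3. A = c1 *\<^sub>R elem_mat 1 1 + c2 *\<^sub>R elem_mat 2 2 + c3 *\<^sub>R elem_mat 3 3"
      by (intro exI[of _ "A$1$1"] exI[of _ "A$2$2"] exI[of _ "A$3$3"])
         (simp add: vec_eq_iff forall_3 elem_mat_component)
  qed
qed

lemma Lambda8_obstruction:
  assumes "a \<noteq> 0 \<or> b \<noteq> 0" "\<epsilon> \<noteq> 0"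
  shows "\<not> srmi (Lambda8 \<epsilon> a b)" "dim (stabilizer (Lambda8 \<epsilon> a b)) \<le> 3"
proof -
  have "a \<noteq> 0 \<or> (a + b)/2 \<noteq> 0"
    using assms(1) by auto
  note S = stabilizer_Lambda8[OF _ this assms(2)]
  show "\<not> srmi (Lambda8 \<epsilon> a b)"
    unfolding Lambda8_def xyz_eq
    by (rule not_srmiI[where \<phi> = "\<lambda>Q. Q (vec3 0 0 1) $ 1 $ 2"])
       (simp_all add: add_field_def scale_field_def wedge_field_def wedge_def J1_3 S assms(2))
  show "dim (stabilizer (Lambda8 \<epsilon> a b)) \<le> 3"
    unfolding Lambda8_def xyz_eq
  proof (rule dim_le_3I)
    fix A assume "A \<in> stabilizer (\<lambda>v::real^3. bivec (a * v$1 * v$3) (a * v$2 * v$3)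
      ((a + b)/2 * ((v$1)\<^sup>2 + (v$2)\<^sup>2) + \<epsilon> * (v$3)\<^sup>2))"
    from S[OF this] show "\<exists>c1 c2 c3. A = c1 *\<^sub>R (elem_mat 1 1 + elem_mat 2 2 + elem_mat 3 3)
      + c2 *\<^sub>R (elem_mat 1 2 - elem_mat 2 1) + c3 *\<^sub>R 0"
      by (intro exI[of _ "A$2$2"] exI[of _ "A$1$2"] exI[of _ 0])
         (simp add: vec_eq_iff forall_3 elem_mat_component)
  qed
qed

lemma Lambda10_obstruction:
  assumes "a \<noteq> - (1/3)"
  shows "\<not> srmi (Lambda10 a)" "dim (stabilizer (Lambda10 a)) \<le> 3"
proof -
  note S = stabilizer_Lambda10[OF _ assms]
  show "\<not> srmi (Lambda10 a)"
    unfolding Lambda10_def xyz_eq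
    \<comment> \<open>Wedge products of stabilizing fields are multiples of that of the first two
      fields of family D, whose 23-coefficient is \<open>y^2 - x*z\<close>; the two contributions
      cancel. The tensor gives \<open>a - (4*a + 1) = - (3*a + 1)\<close>.\<close>
    by (rule not_srmiI[where \<phi> = "\<lambda>Q. Q (vec3 1 0 1) $ 2 $ 3 - Q (vec3 1 0 0) $ 2 $ 3
          - Q (vec3 0 0 1) $ 2 $ 3 + Q (vec3 0 1 0) $ 2 $ 3"])
       (use assms in \<open>simp_all add: add_field_def scale_field_def wedge_field_def wedge_def J1_3 S algebra_simps\<close>)
  show "dim (stabilizer (Lambda10 a)) \<le> 3"
    unfolding Lambda10_def xyz_eq
  proof (rule dim_le_3I)
    fix A assume "A \<in> stabilizer (\<lambda>v::real^3. bivec (a * (v$2)\<^sup>2 - (4 * a + 1) * v$1 * v$3)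
      ((2 * a + 1) * v$1 * v$2) (- (2 * a + 1) * (v$1)\<^sup>2))"
    from S[OF this] show "\<exists>c1 c2 c3. A = c1 *\<^sub>R (elem_mat 1 1 + elem_mat 2 2 + elem_mat 3 3)
      + c2 *\<^sub>R (elem_mat 1 2 + elem_mat 2 3) + c3 *\<^sub>R 0"
      by (intro exI[of _ "A$2$2"] exI[of _ "A$1$2"] exI[of _ 0])
         (simp add: vec_eq_iff forall_3 elem_mat_component)
  qed
qed

lemma dim_stabilizer_family_E:
  assumes "e = 0 \<and> f = 0 \<and> c \<noteq> 0 \<or> e = 1 \<and> f = 2"
  shows "dim (stabilizer (\<lambda>v. bivec (d * (v$1)\<^sup>2 + (2 * b + 1) * v$1 * v$3 + e * (v$3)\<^sup>2) 0
      (b * (v$1)\<^sup>2 + c * (v$3)\<^sup>2 + f * v$1 * v$3))) \<le> 3" (is "dim ?S \<le> 3")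
proof (rule dim_le_3I)
  fix A assume "A \<in> ?S"
  from stabilizer_family_E[OF this assms]
  show "\<exists>c1 c2 c3. A = c1 *\<^sub>R (elem_mat 1 1 + elem_mat 2 2 + elem_mat 3 3)
      + c2 *\<^sub>R elem_mat 1 2 + c3 *\<^sub>R elem_mat 3 2"
    by (intro exI[of _ "A$2$2"] exI[of _ "A$1$2"] exI[of _ "A$3$2"])
       (simp add: vec_eq_iff forall_3 elem_mat_component)
qed

lemma not_srmi_family_E:
  assumes "e = 0 \<and> f = 0 \<and> c \<noteq> 0"
  shows "\<not> srmi (\<lambda>v. bivec (d * (v$1)\<^sup>2 + (2 * b + 1) * v$1 * v$3 + e * (v$3)\<^sup>2) 0
      (b * (v$1)\<^sup>2 + c * (v$3)\<^sup>2 + f * v$1 * v$3))"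
proof (rule not_srmiI[where \<phi> = "\<lambda>Q. Q (vec3 0 0 1) $ 1 $ 2"], goal_cases)
  case (3 A B)
  note S = stabilizer_family_E[OF _ disjI1[OF assms]]
  \<comment> \<open>At \<open>(0, 0, 1)\<close> the first component of each field is the entry
    \<open>A$3$1\<close> or \<open>B$3$1\<close>, which is 0.\<close>
  from S(6)[OF 3(1)] S(6)[OF 3(2)] show ?case
    by (simp add: wedge_field_def wedge_def J1_3)
qed (use assms in \<open>simp_all add: add_field_def scale_field_def\<close>)

lemma Lambda11_12_obstruction:
  assumes "c \<noteq> 0"
  shows "\<not> srmi (Lambda11 b c)" "dim (stabilizer (Lambda11 b c)) \<le> 3"
    "\<not> srmi (Lambda12 b c)" "dim (stabilizer (Lambda12 b c)) \<le> 3"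
  unfolding Lambda11_13_eq using assms
  by (simp_all only: not_srmi_family_E dim_stabilizer_family_E simp_thms)

lemma Lambda13_obstruction: "\<not> srmi (Lambda13 a b c)" "dim (stabilizer (Lambda13 a b c)) \<le> 3"
proof -
  have c: "(1::real) = 0 \<and> (2::real) = 0 \<and> c \<noteq> 0 \<or> (1::real) = 1 \<and> (2::real) = 2"
    by simp
  note S = stabilizer_family_E[OF _ c]
  show "\<not> srmi (Lambda13 a b c)"
    unfolding Lambda11_13_eq
    \<comment> \<open>Stabilizing fields combine the Euler field with \<open>x\<close> and
      \<open>z\<close> times the second axis. The Euler field wedged with the latter has
      \<open>xz\<close> in component 12 and \<open>- z^2\<close> in component 23, which cancel,
      whereas the tensor gives 2 + 1.\<close>
    by (rule not_srmiI[where \<phi> = "\<lambda>Q. Q (vec3 1 0 1) $ 1 $ 2 - Q (vec3 1 0 0) $ 1 $ 2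
          - Q (vec3 0 0 1) $ 1 $ 2 + Q (vec3 0 0 1) $ 2 $ 3"])
       (simp_all add: add_field_def scale_field_def wedge_field_def wedge_def J1_3 S algebra_simps)
  show "dim (stabilizer (Lambda13 a b c)) \<le> 3"
    unfolding Lambda11_13_eq by (rule dim_stabilizer_family_E[OF c])
qed

subsection \<open>The classification\<close>

text \<open>Names the existential claim of the theorem's first part, so that it can be carried along
  with \<open>srmi\<close>.\<close>

definition abelian_wedge_comb :: "(real^'n \<Rightarrow> real^'n^'n) \<Rightarrow> bool" where
  "abelian_wedge_comb P \<longleftrightarrow> (\<exists>Y1 Y2 Y3 \<alpha> \<beta> \<gamma>.
     linear Y1 \<and> linear Y2 \<and> linear Y3 \<and>
     (\<forall>v. lie_field Y1 Y2 v = 0) \<and> (\<forall>v. lie_field Y2 Y3 v = 0) \<and> (\<forall>v. lie_field Y3 Y1 v = 0) \<and>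
     P = wedge_comb Y1 Y2 Y3 \<alpha> \<beta> \<gamma>)"

lemma abelian_wedge_comb_J1:
  assumes "gl_bracket A B = 0" "gl_bracket B C = 0" "gl_bracket C A = 0"
  shows "abelian_wedge_comb (wedge_comb (J1 A) (J1 B) (J1 C) \<alpha> \<beta> \<gamma>)"
  unfolding abelian_wedge_comb_def using assms
  by (intro exI[of _ "J1 A"] exI[of _ "J1 B"] exI[of _ "J1 C"] exI)
     (auto simp: linear_J1 lie_field_J1 linear_0[OF linear_J1_matrix])

text \<open>Row \<open>i\<close> of the matrix of a linear field holds the coefficients of \<open>x\<^sub>i\<close>.\<close>

lemma vec3_field_eq_J1:
  "xyz (\<lambda>x y z. vec3 (a1*x + a2*y + a3*z) (b1*x + b2*y + b3*z) (c1*x + c2*y + c3*z))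
   = J1 (vector [vector [a1, b1, c1], vector [a2, b2, c2], vector [a3, b3, c3]])"
  by (simp add: fun_eq_iff vec_eq_iff forall_3 xyz_def J1_3)

lemma srmi_abelian_wedge_combI:
  fixes A B C :: "real^3^3"
  assumes "P = wedge_comb (J1 A) (J1 B) (J1 C) \<alpha> \<beta> \<gamma>"
    and "A ** B = B ** A" "B ** C = C ** B" "C ** A = A ** C"
  shows "srmi P \<and> abelian_wedge_comb P"
  using assms by (simp add: srmi_wedge_comb abelian_wedge_comb_J1 gl_bracket_def)

lemma comb_srmi_abelian:
  "srmi (comb_A \<alpha> \<beta> \<gamma>) \<and> abelian_wedge_comb (comb_A \<alpha> \<beta> \<gamma>)"
  "srmi (comb_B \<alpha> \<beta> \<gamma>) \<and> abelian_wedge_comb (comb_B \<alpha> \<beta> \<gamma>)"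
  "srmi (comb_C \<alpha> \<beta> \<gamma>) \<and> abelian_wedge_comb (comb_C \<alpha> \<beta> \<gamma>)"
  "srmi (comb_D \<alpha> \<beta> \<gamma>) \<and> abelian_wedge_comb (comb_D \<alpha> \<beta> \<gamma>)"
  "srmi (comb_E a b \<alpha> \<beta> \<gamma>) \<and> abelian_wedge_comb (comb_E a b \<alpha> \<beta> \<gamma>)"
  \<comment> \<open>One instance per field: the three of family A, two new ones of B, one of C,
    three of D, and the third field of E; the others recur.\<close>
  using vec3_field_eq_J1[of 1 0 0 0 0 0 0 0 0] vec3_field_eq_J1[of 0 0 0 0 1 0 0 0 0]
    vec3_field_eq_J1[of 0 0 0 0 0 0 0 0 1] vec3_field_eq_J1[of 1 0 0 0 1 0 0 0 0]
    vec3_field_eq_J1[of 0 "-1" 0 1 0 0 0 0 0] vec3_field_eq_J1[of 0 0 0 1 0 0 0 0 0]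
    vec3_field_eq_J1[of 1 0 0 0 1 0 0 0 1] vec3_field_eq_J1[of 0 0 0 1 0 0 0 1 0]
    vec3_field_eq_J1[of 0 0 0 0 0 0 1 0 0] vec3_field_eq_J1[of 0 0 0 0 0 0 a 0 "3*b+1"]
  unfolding comb_A_def comb_B_def comb_C_def comb_D_def comb_E_def
  by - (rule srmi_abelian_wedge_combI, simp,
     simp_all add: vec_eq_iff forall_3 matrix_matrix_mult_def sum_3)+

text \<open>The tensor is the wedge product of \<open>z\<close> times the first axis and
  \<open>z\<close> times the second, scaled by \<open>\<gamma>\<close>; these fields commute since
  the products of their matrices vanish.\<close>

lemma z2_srmi_abelian:
  "srmi (\<lambda>v::real^3. bivec 0 0 (\<gamma> * (v$3)\<^sup>2)) \<and> abelian_wedge_comb (\<lambda>v::real^3. bivec 0 0 (\<gamma> * (v$3)\<^sup>2))"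
proof (rule srmi_abelian_wedge_combI)
  show "(\<lambda>v::real^3. bivec 0 0 (\<gamma> * (v$3)\<^sup>2))
    = wedge_comb (J1 (elem_mat 3 1)) (J1 (elem_mat 3 2)) (J1 0) 0 0 \<gamma>"
    by (simp add: wedge_comb_def wedge_field_def wedge_def fun_eq_iff vec_eq_iff forall_3 J1_3
        elem_mat_component power2_eq_square)
qed (simp_all add: vec_eq_iff forall_3 matrix_matrix_mult_def sum_3 elem_mat_component)

text \<open>At the exceptional parameters either the remainder disappears (classes 10, 11, 12) or
  the combination does, leaving a multiple of \<open>z^2\<close> in component 12 (classes 4 and
  8).\<close>

lemma Lambda_srmi_abelian:
  "srmi (Lambda4 0 0) \<and> abelian_wedge_comb (Lambda4 0 0)"
  "srmi (Lambda8 \<epsilon> 0 0) \<and> abelian_wedge_comb (Lambda8 \<epsilon> 0 0)"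
  "srmi (Lambda10 (- (1/3))) \<and> abelian_wedge_comb (Lambda10 (- (1/3)))"
  "srmi (Lambda11 b 0) \<and> abelian_wedge_comb (Lambda11 b 0)"
  "srmi (Lambda12 b 0) \<and> abelian_wedge_comb (Lambda12 b 0)"
proof -
  have "Lambda4 0 0 = (\<lambda>v. bivec 0 0 (1 * (v$3)\<^sup>2))" "Lambda8 \<epsilon> 0 0 = (\<lambda>v. bivec 0 0 (\<epsilon> * (v$3)\<^sup>2))"
    "Lambda10 (- (1/3)) = comb_D 0 0 (- (1/3))" "Lambda11 b 0 = comb_E 0 b 1 0 b"
    "Lambda12 b 0 = comb_E 1 b 1 0 b"
    by (simp_all add: Lambda4_def Lambda8_def Lambda10_def Lambda11_def Lambda12_def xyz_eq comb_eqs
        fun_eq_iff bivec_eq_iff field_simps)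
  then show "srmi (Lambda4 0 0) \<and> abelian_wedge_comb (Lambda4 0 0)"
    "srmi (Lambda8 \<epsilon> 0 0) \<and> abelian_wedge_comb (Lambda8 \<epsilon> 0 0)"
    "srmi (Lambda10 (- (1/3))) \<and> abelian_wedge_comb (Lambda10 (- (1/3)))"
    "srmi (Lambda11 b 0) \<and> abelian_wedge_comb (Lambda11 b 0)"
    "srmi (Lambda12 b 0) \<and> abelian_wedge_comb (Lambda12 b 0)"
    by (simp_all only: z2_srmi_abelian comb_srmi_abelian simp_thms)
qed

lemma srmi_iff:
  "srmi (Lambda4 a b) \<longleftrightarrow> (a, b) = (0, 0)"
  "\<epsilon> \<noteq> 0 \<Longrightarrow> srmi (Lambda8 \<epsilon> a b) \<longleftrightarrow> (a, b) = (0, 0)"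
  "srmi (Lambda10 a) \<longleftrightarrow> a = - (1/3)"
  "srmi (Lambda11 b c) \<longleftrightarrow> c = 0"
  "srmi (Lambda12 b c) \<longleftrightarrow> c = 0"
proof -
  show "srmi (Lambda4 a b) \<longleftrightarrow> (a, b) = (0, 0)"
    using Lambda_srmi_abelian(1) Lambda4_obstruction(1) by auto
  show "srmi (Lambda8 \<epsilon> a b) \<longleftrightarrow> (a, b) = (0, 0)" if "\<epsilon> \<noteq> 0"
    using Lambda_srmi_abelian(2) Lambda8_obstruction(1) that by auto
  show "srmi (Lambda10 a) \<longleftrightarrow> a = - (1/3)"
    using Lambda_srmi_abelian(3) Lambda10_obstruction(1) by auto
  show "srmi (Lambda11 b c) \<longleftrightarrow> c = 0"
    using Lambda_srmi_abelian(4) Lambda11_12_obstruction(1)[of c b] by auto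
  show "srmi (Lambda12 b c) \<longleftrightarrow> c = 0"
    using Lambda_srmi_abelian(5) Lambda11_12_obstruction(3)[of c b] by auto
qed

text \<open>Classes that are pure combinations are covered by \<open>comb_srmi_abelian\<close>. For
  the others the dimension bounds leave only the exceptional parameters, and class 13 has
  none.\<close>

lemma dufour_haraki_dim_stabilizer:
  assumes "P \<in> dufour_haraki" "dim (stabilizer P) > 3"
  shows "abelian_wedge_comb P \<and> srmi P"
proof -
  have 4: "a = 0 \<and> b = 0" if "dim (stabilizer (Lambda4 a b)) > 3" for a b
    using Lambda4_obstruction(2)[of a b] that by auto
  have 8: "a = 0 \<and> b = 0" if "dim (stabilizer (Lambda8 \<epsilon> a b)) > 3" "\<epsilon> \<noteq> 0" for \<epsilon> a b
    using Lambda8_obstruction(2)[of a b \<epsilon>] that by auto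
  have 10: "a = - (1/3)" if "dim (stabilizer (Lambda10 a)) > 3" for a
    using Lambda10_obstruction(2)[of a] that by auto
  have 11: "c = 0" if "dim (stabilizer (Lambda11 b c)) > 3" for b c
    using Lambda11_12_obstruction(2)[of c b] that by auto
  have 12: "c = 0" if "dim (stabilizer (Lambda12 b c)) > 3" for b c
    using Lambda11_12_obstruction(4)[of c b] that by auto
  have 13: False if "dim (stabilizer (Lambda13 a b c)) > 3" for a b c
    using Lambda13_obstruction(2)[of a b c] that by auto
  show ?thesis
    using assms unfolding dufour_haraki_def
    by (auto simp: Lambda_eq_comb comb_srmi_abelian Lambda_srmi_abelian
        dest!: 4 8 10 11 12 13)
qed

lemma dufour_haraki_quadratic_poisson: "P \<in> dufour_haraki \<Longrightarrow> quadratic_poisson P"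
  unfolding dufour_haraki_def
  by (auto simp: Lambda_eq_comb quadratic_poisson_comb quadratic_poisson_Lambda)

theorem theorem2:
  shows
   "(\<forall>\<Lambda>\<in>dufour_haraki. quadratic_poisson \<Lambda> \<and>
      (dim (stabilizer \<Lambda>) > 3 \<longrightarrow>
        (\<exists>Y1 Y2 Y3 :: real^3 \<Rightarrow> real^3. \<exists>\<alpha> \<beta> \<gamma> :: real.
           linear Y1 \<and> linear Y2 \<and> linear Y3 \<and>
           (\<forall>v. lie_field Y1 Y2 v = 0) \<and> (\<forall>v. lie_field Y2 Y3 v = 0) \<and> (\<forall>v. lie_field Y3 Y1 v = 0) \<and>
           \<Lambda> = wedge_comb Y1 Y2 Y3 \<alpha> \<beta> \<gamma>) \<and>
        srmi \<Lambda>)) \<and>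
    (\<forall>a b c :: real.
      \<comment> \<open>family A\<close>
      srmi (Lambda1 a b c) \<and> Lambda1 a b c = comb_A a b c \<and>
      (\<not> srmi (Lambda4 a b) \<longleftrightarrow> (a, b) \<noteq> (0, 0)) \<and>
      Lambda4 a b = add_field (comb_A a a b) (scale_field (1/3) (Pi_field (xyz (\<lambda>x y z. z^3)))) \<and>
      (\<not> srmi (Lambda4 a b) \<longrightarrow> srmi_splitting (comb_A a a b) (scale_field (1/3) (Pi_field (xyz (\<lambda>x y z. z^3))))) \<and>
      \<comment> \<open>family B\<close>
      srmi (Lambda2 a b) \<and> Lambda2 a b = comb_B (2*a) b a \<and>
      srmi (Lambda7 a b c) \<and> Lambda7 a b c = comb_B (2*a + c) b a \<and>
      (\<forall>\<epsilon>\<in>{1, -1}.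
        (\<not> srmi (Lambda8 \<epsilon> a b) \<longleftrightarrow> (a, b) \<noteq> (0, 0)) \<and>
        Lambda8 \<epsilon> a b = add_field (comb_B a 0 ((a + b)/2)) (scale_field (\<epsilon>/3) (Pi_field (xyz (\<lambda>x y z. z^3)))) \<and>
        (\<not> srmi (Lambda8 \<epsilon> a b) \<longrightarrow>
          srmi_splitting (comb_B a 0 ((a + b)/2)) (scale_field (\<epsilon>/3) (Pi_field (xyz (\<lambda>x y z. z^3)))))) \<and>
      \<comment> \<open>family C\<close>
      srmi (Lambda3 a) \<and> Lambda3 a = comb_C 2 a 1 \<and>
      (a \<noteq> - (1/2) \<longrightarrow> srmi (Lambda5 a) \<and> Lambda5 a = comb_C (2*a + 1) (-1) a) \<and>
      srmi (Lambda6 a) \<and> Lambda6 a = comb_C 0 (- a) (- (1/2)) \<and>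
      \<comment> \<open>family D\<close>
      srmi (Lambda9 a) \<and> Lambda9 a = comb_D a 0 (- (1/3)) \<and>
      (\<not> srmi (Lambda10 a) \<longleftrightarrow> a \<noteq> - (1/3)) \<and>
      Lambda10 a = add_field (comb_D 0 0 (- (2*a + 1)))
                     (xyz (\<lambda>x y z. bivec ((3*a + 1) * (y^2 - 2*x*z)) 0 0)) \<and>
      (\<not> srmi (Lambda10 a) \<longrightarrow>
        srmi_splitting (comb_D 0 0 (- (2*a + 1)))
          (xyz (\<lambda>x y z. bivec ((3*a + 1) * (y^2 - 2*x*z)) 0 0))) \<and>
      \<comment> \<open>family E\<close>
      (\<not> srmi (Lambda11 b c) \<longleftrightarrow> c \<noteq> 0) \<and>
      Lambda11 b c = add_field (comb_E 0 b 1 0 b) (scale_field (c/3) (Pi_field (xyz (\<lambda>x y z. z^3)))) \<and>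
      (\<not> srmi (Lambda11 b c) \<longrightarrow>
        srmi_splitting (comb_E 0 b 1 0 b) (scale_field (c/3) (Pi_field (xyz (\<lambda>x y z. z^3))))) \<and>
      (\<not> srmi (Lambda12 b c) \<longleftrightarrow> c \<noteq> 0) \<and>
      Lambda12 b c = add_field (comb_E 1 b 1 0 b) (scale_field (c/3) (Pi_field (xyz (\<lambda>x y z. z^3)))) \<and>
      (\<not> srmi (Lambda12 b c) \<longrightarrow>
        srmi_splitting (comb_E 1 b 1 0 b) (scale_field (c/3) (Pi_field (xyz (\<lambda>x y z. z^3))))) \<and>
      \<not> srmi (Lambda13 a b c) \<and>
      Lambda13 a b c = add_field (comb_E a b 1 0 b) (Pi_field (xyz (\<lambda>x y z. c/3 * z^3 + x * z^2))) \<and>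
      srmi_splitting (comb_E a b 1 0 b) (Pi_field (xyz (\<lambda>x y z. c/3 * z^3 + x * z^2))))"
proof (intro conjI ballI allI impI)
  fix P assume P: "P \<in> dufour_haraki"
  show "quadratic_poisson P"
    using P by (rule dufour_haraki_quadratic_poisson)
  assume "dim (stabilizer P) > 3"
  with P have ab: "abelian_wedge_comb P \<and> srmi P"
    by (rule dufour_haraki_dim_stabilizer)
  from ab show "srmi P" ..
  from ab[THEN conjunct1] show "\<exists>Y1 Y2 Y3 :: real^3 \<Rightarrow> real^3. \<exists>\<alpha> \<beta> \<gamma> :: real.
           linear Y1 \<and> linear Y2 \<and> linear Y3 \<and>
           (\<forall>v. lie_field Y1 Y2 v = 0) \<and> (\<forall>v. lie_field Y2 Y3 v = 0) \<and> (\<forall>v. lie_field Y3 Y1 v = 0) \<and>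
           P = wedge_comb Y1 Y2 Y3 \<alpha> \<beta> \<gamma>"
    unfolding abelian_wedge_comb_def .
\<comment> \<open>The splittings are read from right to left, folding each sum back into its tensor
  so that \<open>srmi_iff\<close> still applies.\<close>
qed (auto simp only: srmi_iff srmi_splitting_def comb_srmi_abelian quadratic_poisson_comb quadratic_poisson_remainder
   compatible_split Lambda_eq_comb Lambda13_obstruction(1) simp_thms
   Lambda4_split[symmetric] Lambda8_split[symmetric] Lambda10_split[symmetric]
   Lambda11_split[symmetric] Lambda12_split[symmetric] Lambda13_split[symmetric])

end
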